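(* There is a function $\varepsilon:\mathbb{R}_{\geq 0}^2\to\mathbb{R}_{\geq 0}$ with $\varepsilon(\mu,r)\to 0$ whenever $\mu r\to\infty$ such that the following holds. Let $H$ be an $r$-uniform $\mu$-near-regular hypergraph of girth at least $4$. Then $H$ has a $t(\mu,r)$-shallow hitting edge set, where \[ t(\mu,r)=c\,\mu\ln(r)\,(1+\varepsilon(\mu,r)) = O(\mu\ln r),\qquad c=\mathrm{e}^{1+W(2/(\mathrm{e}\mu))}=\mathrm{e}+o_\mu(1). \]
   Context: A hypergraph $H=(V,E)$ has a finite vertex set $V$ and a finite multiset $E$ of subsets of $V$ (edges). $H$ is $r$-uniform if every edge has exactly $r$ vertices; $\Delta,\delta$ denote maximum and minimum vertex degree; $H$ is $\mu$-near-regular if $\delta>0$ and $\Delta/\delta\le\mu$. A cycle of length $k$ is a sequence $v_1e_1v_2e_2\dots v_ke_kv_{k+1}$ of distinct vertices $v_1,\dots,v_k$ and distinct edges $e_1,\dots,e_k$ with $v_{k+1}=v_1$ and $\{v_i,v_{i+1}\}\subseteq e_i$ for all $i$; the girth is the smallest length of a cycle. For $M\subseteq E$, $\deg_M(v)$ is the number of edges of $M$ containing $v$; $M$ is hitting if $\deg_M(v)\ge 1$ for all $v$ and $t$-shallow if $\deg_M(v)\le t$ for all $v$. $W$ is the Lambert $W$-function, defined by $x=W(x)\mathrm{e}^{W(x)}$ for $x\ge-\mathrm{e}^{-1}$. $o_\mu(1)$ denotes a quantity tending to $0$ as $\mu\to\infty$.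
   Formalization: The uniformity r is assumed to be at least 2: for r = 1 the bound t(μ,r) is 0 since ln 1 = 0, so the claim fails (one vertex with one singleton edge, μ = 1). *)

theory Defs
  imports "HOL-Analysis.Analysis" "HOL-Library.Multiset" "HOL-Library.Extended_Nat"
    "HOL-Library.Landau_Symbols"
begin

definition hypergraph :: "'a set \<Rightarrow> 'a set multiset \<Rightarrow> bool" where
  "hypergraph V E \<longleftrightarrow> finite V \<and> (\<forall>e\<in>#E. e \<subseteq> V)"

definition uniform :: "nat \<Rightarrow> 'a set multiset \<Rightarrow> bool" where
  "uniform r E \<longleftrightarrow> (\<forall>e\<in>#E. card e = r)"

(* Parallel edges are counted with multiplicity. *)
definition degree_in :: "'a set multiset \<Rightarrow> 'a \<Rightarrow> nat" where
  "degree_in M v = size {# e \<in># M. v \<in> e #}"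

definition max_deg :: "'a set \<Rightarrow> 'a set multiset \<Rightarrow> nat" where
  "max_deg V E = Max (degree_in E ` V)"

definition min_deg :: "'a set \<Rightarrow> 'a set multiset \<Rightarrow> nat" where
  "min_deg V E = Min (degree_in E ` V)"

(* For V = {} the extreme degrees, and hence this predicate, are unspecified. *)
definition near_regular :: "real \<Rightarrow> 'a set \<Rightarrow> 'a set multiset \<Rightarrow> bool" where
  "near_regular \<mu> V E \<longleftrightarrow>
     min_deg V E > 0 \<and> real (max_deg V E) / real (min_deg V E) \<le> \<mu>"

(* The lists vs and es hold v_1, ..., v_k and e_1, ..., e_k, indexed from 0; the index modulo k
   encodes v_{k+1} = v_1. Distinctness of the edges is that of the members of the multiset E:
   mset es \<subseteq># E lets parallel edges occur as different edges of a cycle, so that two parallel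
   edges with at least two vertices form a cycle of length 2.
   As usual, k \<ge> 2: with k = 1 any vertex and edge containing it would be a cycle. *)
definition is_cycle :: "'a set multiset \<Rightarrow> 'a list \<Rightarrow> 'a set list \<Rightarrow> bool" where
  "is_cycle E vs es \<longleftrightarrow>
     length vs \<ge> 2 \<and> length es = length vs \<and> distinct vs \<and> mset es \<subseteq># E \<and>
     (\<forall>i < length vs. {vs ! i, vs ! (Suc i mod length vs)} \<subseteq> es ! i)"

(* The girth is \<infinity> if there is no cycle. *)
definition girth :: "'a set multiset \<Rightarrow> enat" where
  "girth E = Inf {enat (length vs) | vs es. is_cycle E vs es}"

definition hitting :: "'a set \<Rightarrow> 'a set multiset \<Rightarrow> bool" where
  "hitting V M \<longleftrightarrow> (\<forall>v\<in>V. degree_in M v \<ge> 1)"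

definition shallow :: "real \<Rightarrow> 'a set \<Rightarrow> 'a set multiset \<Rightarrow> bool" where
  "shallow t V M \<longleftrightarrow> (\<forall>v\<in>V. real (degree_in M v) \<le> t)"

(* The principal branch. On [-1/e, 0) the equation has a second solution, below -1. *)
definition lambert_W :: "real \<Rightarrow> real" where
  "lambert_W x = (THE w. w \<ge> -1 \<and> w * exp w = x)"

lemma lambert_W_ex1:
  fixes x :: real
  assumes "x \<ge> - exp (-1)"
  shows "\<exists>!w. w \<ge> -1 \<and> w * exp w = x"
proof (rule ex_ex1I)
  have "max 0 x * exp (max 0 x) \<ge> x"
    using mult_left_mono[of 1 "exp x" x] by (cases "x \<ge> 0") auto
  moreover have "(-1) * exp (-1) \<le> x" using assms by simp
  moreover have "continuous_on {-1..max 0 x} (\<lambda>w. w * exp w)"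
    by (intro continuous_intros)
  ultimately show "\<exists>w. w \<ge> -1 \<and> w * exp w = x"
    using IVT'[of "\<lambda>w. w * exp w" "-1" x "max 0 x"] by (fastforce simp: le_max_iff_disj)
next
  have mono: "u * exp u < w * exp w" if "-1 \<le> u" "u < w" for u w :: real
  proof (rule DERIV_pos_imp_increasing_open[OF \<open>u < w\<close>])
    fix z assume "u < z" "z < w"
    have "((\<lambda>w. w * exp w) has_real_derivative (1 + z) * exp z) (at z)"
      by (auto intro!: derivative_eq_intros simp: algebra_simps)
    moreover have "(1 + z) * exp z > 0" using \<open>u < z\<close> that by simp
    ultimately show "\<exists>y. ((\<lambda>w. w * exp w) has_real_derivative y) (at z) \<and> y > 0" by blast
  qed (intro continuous_intros)
  fix u w :: real
  assume "u \<ge> -1 \<and> u * exp u = x" "w \<ge> -1 \<and> w * exp w = x"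
  then show "u = w" using mono[of u w] mono[of w u] by (cases u w rule: linorder_cases) auto
qed

lemma lambert_W:
  assumes "x \<ge> - exp (-1)"
  shows "lambert_W x \<ge> -1" "lambert_W x * exp (lambert_W x) = x"
  using theI'[OF lambert_W_ex1[OF assms]] unfolding lambert_W_def by auto

definition c_const :: "real \<Rightarrow> real" where
  "c_const \<mu> = exp (1 + lambert_W (2 / (exp 1 * \<mu>)))"

definition t_bound :: "(real \<Rightarrow> real \<Rightarrow> real) \<Rightarrow> real \<Rightarrow> real \<Rightarrow> real" where
  "t_bound \<epsilon> \<mu> r = c_const \<mu> * \<mu> * ln r * (1 + \<epsilon> \<mu> r)"

(* The filter of pairs of nonnegative reals with x * y tending to infinity. *)
definition prod_at_top :: "(real \<times> real) filter" where
  "prod_at_top =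
     inf (filtercomap (\<lambda>(x, y). x * y) at_top) (principal ({0..} \<times> {0..}))"

lemma eventually_prod_at_top:
  "eventually P prod_at_top \<longleftrightarrow> (\<exists>K. \<forall>x\<ge>0. \<forall>y\<ge>0. x * y \<ge> K \<longrightarrow> P (x, y))"
proof
  assume "eventually P prod_at_top"
  then obtain Q K where "\<forall>z\<ge>K. Q z"
    "\<forall>x y. Q (x * y) \<longrightarrow> (x, y) \<in> {0..} \<times> {0..} \<longrightarrow> P (x, y)"
    unfolding prod_at_top_def eventually_inf_principal eventually_filtercomap
      eventually_at_top_linorder by auto
  then show "\<exists>K. \<forall>x\<ge>0. \<forall>y\<ge>0. x * y \<ge> K \<longrightarrow> P (x, y)"
    by (intro exI[of _ K]) simp
next
  assume "\<exists>K. \<forall>x\<ge>0. \<forall>y\<ge>0. x * y \<ge> K \<longrightarrow> P (x, y)"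
  then obtain K where "\<forall>x\<ge>0. \<forall>y\<ge>0. x * y \<ge> K \<longrightarrow> P (x, y)" by blast
  then show "eventually P prod_at_top"
    unfolding prod_at_top_def eventually_inf_principal eventually_filtercomap
    by (intro exI[of _ "\<lambda>z. z \<ge> K"]) (auto simp: eventually_ge_at_top)
qed

end

theory Submission
  imports Defs "HOL-Probability.Probability" "HOL-Real_Asymp.Real_Asymp"
begin

text \<open>By the Lovasz local lemma, keeping every edge with probability \<open>1/16\<close> scales all degrees by
  almost the same factor. Repeating this until the degrees are polylogarithmic in \<open>\<mu> r\<close> leaves a
  subhypergraph that is \<open>\<mu> (1 + o(1))\<close>-near-regular, with minimum degree at least \<open>a\<close>, say. Sample its
  edges with probability \<open>ln r / a\<close> and let every missed vertex take a random edge. A vertex is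
  missed with probability at most \<open>1/r\<close>, so the expected degree is at most about
  \<open>\<mu> (ln r + 1)\<close>. Girth at least 4 makes the choices of the edges at a vertex independent, and
  Chernoff's bound gives \<open>P(deg > c \<mu> ln r) \<le> r^-(2 + \<mu> - o(1))\<close>. This event depends on at most
  \<open>r^(3 + o(1))\<close> others, so the local lemma applies again, the factor \<open>1 + \<epsilon>\<close> absorbing the
  \<open>o(1)\<close> terms.\<close>

subsection \<open>Independence and the local lemma in finite product spaces\<close>

text \<open>Sparsification is needed because the dependencies in the last application of the local
  lemma grow with the degrees, which may be huge compared with \<mu> and r. It goes by constant
  factors: a single jump would have failure probabilities governed by the small target degrees, but
  dependencies governed by the huge initial ones. For s the fourth root of the degree, the relative
  errors 1/s double from step to step, so the last one dominates.

  The constant c comes from Chernoff's bound. For mean \<mu> ln r and threshold c \<mu> ln r the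
  best base is c, and it gives r to the power \<mu> (c - 1) - c \<mu> ln c. Setting this to -(\<mu>
  + 2), which is at most -3, means c \<mu> ln c = c \<mu> + 2; with c = e^(1 + w) this reads w e^w =
  2/(e \<mu>).

  Since \<epsilon> must also vanish for bounded r and growing \<mu>, two ranges are separated: above
  a constant \<mu> the error is 0, and below it \<mu> r tends to infinity only together with
  r.\<close>

definition depends_on :: "(('i \<Rightarrow> 'b) \<Rightarrow> 'c) \<Rightarrow> 'i set \<Rightarrow> bool" where
  "depends_on f S \<longleftrightarrow> (\<forall>\<omega> \<omega>'. (\<forall>i\<in>S. \<omega> i = \<omega>' i) \<longrightarrow> f \<omega> = f \<omega>')"

lemma depends_onD: "depends_on f S \<Longrightarrow> (\<And>i. i \<in> S \<Longrightarrow> \<omega> i = \<omega>' i) \<Longrightarrow> f \<omega> = f \<omega>'"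
  unfolding depends_on_def by blast

lemma depends_on_compose: "depends_on f S \<Longrightarrow> depends_on (\<lambda>\<omega>. h (f \<omega>)) S"
  unfolding depends_on_def by metis

lemma finite_set_Pi_pmf:
  assumes "finite I" "\<And>i. i \<in> I \<Longrightarrow> finite (set_pmf (p i))"
  shows "finite (set_pmf (Pi_pmf I d p))"
  using assms by (auto simp: set_Pi_pmf)

text \<open>The product measure splits into the coordinates in \<open>S\<close> and the remaining
  ones; \<open>f\<close> reads only the first factor and \<open>g\<close> only the second.\<close>

lemma expectation_mult_Pi_pmf:
  fixes f g :: "('i \<Rightarrow> 'b) \<Rightarrow> real"
  assumes I: "finite I" and fin: "\<And>i. i \<in> I \<Longrightarrow> finite (set_pmf (p i))"
    and f: "depends_on f S" and g: "depends_on g T" and ST: "S \<inter> T = {}"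
  shows "measure_pmf.expectation (Pi_pmf I d p) (\<lambda>\<omega>. f \<omega> * g \<omega>) =
         measure_pmf.expectation (Pi_pmf I d p) f * measure_pmf.expectation (Pi_pmf I d p) g"
proof -
  define P Q where "P = Pi_pmf (I \<inter> S) d p" and "Q = Pi_pmf (I - S) d p"
  \<comment> \<open>Coordinates outside \<open>I\<close> have the value \<open>d\<close> in both
    factors, so taking them from \<open>b\<close> also serves \<open>f\<close>.\<close>
  define mg where "mg = (\<lambda>(a, b) i. if i \<in> I \<inter> S then a i else (b i :: 'b))"
  have split: "Pi_pmf I d p = map_pmf mg (pair_pmf P Q)"
    using Pi_pmf_union[of "I \<inter> S" "I - S" d p] I
    by (auto simp: P_def Q_def mg_def Int_Diff_Un Int_Diff_disjoint)
  have finP: "finite (set_pmf P)" and finQ: "finite (set_pmf Q)"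
    using I fin by (auto simp: P_def Q_def intro!: finite_set_Pi_pmf)
  have outP: "a i = d" if "a \<in> set_pmf P" "i \<notin> I" for a i
    using that I set_Pi_pmf_subset[of "I \<inter> S" d p] unfolding P_def by auto
  have outQ: "b i = d" if "b \<in> set_pmf Q" "i \<notin> I" for b i
    using that I set_Pi_pmf_subset[of "I - S" d p] unfolding Q_def by auto
  have f': "f (mg (a, b)) = f a" if "a \<in> set_pmf P" "b \<in> set_pmf Q" for a b
    by (rule depends_onD[OF f]) (use that outP outQ in \<open>auto simp: mg_def\<close>)
  have g': "g (mg (a, b)) = g b" if "a \<in> set_pmf P" "b \<in> set_pmf Q" for a b
    by (rule depends_onD[OF g]) (use that ST in \<open>auto simp: mg_def\<close>)
  have Ef: "measure_pmf.expectation (Pi_pmf I d p) f = measure_pmf.expectation P f"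
  proof -
    have "measure_pmf.expectation (Pi_pmf I d p) f =
          measure_pmf.expectation (pair_pmf P Q) (\<lambda>x. f (fst x))"
      unfolding split integral_map_pmf
      by (rule integral_cong_AE) (use f' in \<open>auto simp: AE_measure_pmf_iff\<close>)
    then show ?thesis by simp
  qed
  have Eg: "measure_pmf.expectation (Pi_pmf I d p) g = measure_pmf.expectation Q g"
  proof -
    have "measure_pmf.expectation (Pi_pmf I d p) g =
          measure_pmf.expectation (pair_pmf P Q) (\<lambda>x. g (snd x))"
      unfolding split integral_map_pmf
      by (rule integral_cong_AE) (use g' in \<open>auto simp: AE_measure_pmf_iff\<close>)
    then show ?thesis by simp
  qed
  have "measure_pmf.expectation (Pi_pmf I d p) (\<lambda>\<omega>. f \<omega> * g \<omega>) =
        measure_pmf.expectation (pair_pmf P Q) (\<lambda>x. f (fst x) * g (snd x))"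
    unfolding split integral_map_pmf
    by (rule integral_cong_AE) (use f' g' in \<open>auto simp: AE_measure_pmf_iff\<close>)
  also have "\<dots> = (\<Sum>x\<in>set_pmf P \<times> set_pmf Q. (pmf P (fst x) * pmf Q (snd x)) * (f (fst x) * g (snd x)))"
    using finP finQ
    by (subst integral_measure_pmf[where A = "set_pmf P \<times> set_pmf Q"])
       (auto simp: pmf_pair intro!: sum.cong)
  also have "\<dots> = (\<Sum>a\<in>set_pmf P. pmf P a * f a) * (\<Sum>b\<in>set_pmf Q. pmf Q b * g b)"
    by (simp add: sum_product sum.cartesian_product case_prod_unfold mult_ac)
  also have "\<dots> = measure_pmf.expectation P f * measure_pmf.expectation Q g"
    using finP finQ by (simp add: integral_measure_pmf[where A = "set_pmf P"]
        integral_measure_pmf[where A = "set_pmf Q"])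
  finally show ?thesis by (simp add: Ef Eg)
qed

lemma depends_on_prod:
  fixes f :: "'k \<Rightarrow> ('i \<Rightarrow> 'b) \<Rightarrow> 'c::comm_monoid_mult"
  assumes "\<And>k. k \<in> K \<Longrightarrow> depends_on (f k) (S k)"
  shows "depends_on (\<lambda>\<omega>. \<Prod>k\<in>K. f k \<omega>) (\<Union>k\<in>K. S k)"
  unfolding depends_on_def
proof (intro allI impI prod.cong refl)
  fix \<omega> \<omega>' :: "'i \<Rightarrow> 'b" and k assume "\<forall>i\<in>(\<Union>k\<in>K. S k). \<omega> i = \<omega>' i" "k \<in> K"
  then show "f k \<omega> = f k \<omega>'" by (intro depends_onD[OF assms]) auto
qed

lemma expectation_prod_blocks_Pi_pmf:
  fixes f :: "'k \<Rightarrow> ('i \<Rightarrow> 'b) \<Rightarrow> real"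
  assumes I: "finite I" and fin: "\<And>i. i \<in> I \<Longrightarrow> finite (set_pmf (p i))"
    and K: "finite K" and f: "\<And>k. k \<in> K \<Longrightarrow> depends_on (f k) (S k)"
    and disj: "\<And>k l. k \<in> K \<Longrightarrow> l \<in> K \<Longrightarrow> k \<noteq> l \<Longrightarrow> S k \<inter> S l = {}"
  shows "measure_pmf.expectation (Pi_pmf I d p) (\<lambda>\<omega>. \<Prod>k\<in>K. f k \<omega>) =
         (\<Prod>k\<in>K. measure_pmf.expectation (Pi_pmf I d p) (f k))"
  using K f disj
proof (induction rule: finite_induct)
  case (insert k K)
  have "measure_pmf.expectation (Pi_pmf I d p) (\<lambda>\<omega>. f k \<omega> * (\<Prod>k\<in>K. f k \<omega>)) =
        measure_pmf.expectation (Pi_pmf I d p) (f k) *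
        measure_pmf.expectation (Pi_pmf I d p) (\<lambda>\<omega>. \<Prod>k\<in>K. f k \<omega>)"
  proof (rule expectation_mult_Pi_pmf[OF I fin _ depends_on_prod])
    show "depends_on (f k) (S k)" using insert.prems by simp
    show "depends_on (f l) (S l)" if "l \<in> K" for l using insert.prems that by simp
    have "S k \<inter> S l = {}" if "l \<in> K" for l
      using insert.prems(2)[of k l] insert.hyps that by auto
    then show "S k \<inter> (\<Union>l\<in>K. S l) = {}" by blast
  qed
  then show ?case using insert by simp
qed simp

text \<open>By induction on \<open>T\<close>, the probability of a bad event conditional on avoiding all those of
  \<open>T\<close> is at most \<open>2 q\<close>.\<close>

lemma local_lemma_Pi_pmf:
  fixes A :: "'v \<Rightarrow> ('i \<Rightarrow> 'b) \<Rightarrow> bool"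
  assumes I: "finite I" and fin: "\<And>i. i \<in> I \<Longrightarrow> finite (set_pmf (p i))"
    and V: "finite V" and A: "\<And>v. v \<in> V \<Longrightarrow> depends_on (A v) (S v)"
    and q: "\<And>v. v \<in> V \<Longrightarrow> measure_pmf.prob (Pi_pmf I d p) {\<omega>. A v \<omega>} \<le> q"
    and n: "\<And>v. v \<in> V \<Longrightarrow> real (card {w\<in>V. w = v \<or> S w \<inter> S v \<noteq> {}}) \<le> n"
    and qn: "4 * q * n \<le> 1"
  shows "\<exists>\<omega>\<in>set_pmf (Pi_pmf I d p). \<forall>v\<in>V. \<not> A v \<omega>"
proof -
  define \<P> where "\<P> = (\<lambda>X. measure_pmf.prob (Pi_pmf I d p) {\<omega>. X \<omega>})"
  define none where "none = (\<lambda>T \<omega>. \<forall>w\<in>T. \<not> A w \<omega>)"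
  define N where "N = (\<lambda>v. {w\<in>V. w = v \<or> S w \<inter> S v \<noteq> {}})"
  have q0: "q \<ge> 0" if "v \<in> V" for v
    using q[OF that] order_trans[OF measure_nonneg] by blast
  have indep: "\<P> (\<lambda>\<omega>. A v \<omega> \<and> none T \<omega>) = \<P> (A v) * \<P> (none T)"
    if v: "v \<in> V" and T: "T \<subseteq> V" "T \<inter> N v = {}" for v T
  proof -
    have none: "depends_on (none T) (\<Union>w\<in>T. S w)"
      unfolding none_def depends_on_def
    proof (intro allI impI ball_cong refl arg_cong[of _ _ Not])
      fix \<omega> \<omega>' :: "'i \<Rightarrow> 'b" and w assume "\<forall>i\<in>(\<Union>w\<in>T. S w). \<omega> i = \<omega>' i" "w \<in> T"
      then show "A w \<omega> = A w \<omega>'" using T by (intro depends_onD[OF A]) auto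
    qed
    have E: "\<P> X = measure_pmf.expectation (Pi_pmf I d p) (\<lambda>\<omega>. of_bool (X \<omega>))" for X
    proof -
      have "(\<lambda>\<omega>. of_bool (X \<omega>) :: real) = indicator {\<omega>. X \<omega>}" by (auto simp: indicator_def)
      then show ?thesis by (simp add: \<P>_def)
    qed
    have "S w \<inter> S v = {}" if "w \<in> T" for w
      using that T unfolding N_def by blast
    then have "S v \<inter> (\<Union>w\<in>T. S w) = {}" by blast
    then have "measure_pmf.expectation (Pi_pmf I d p) (\<lambda>\<omega>. of_bool (A v \<omega>) * of_bool (none T \<omega>) :: real) =
        measure_pmf.expectation (Pi_pmf I d p) (\<lambda>\<omega>. of_bool (A v \<omega>)) *
        measure_pmf.expectation (Pi_pmf I d p) (\<lambda>\<omega>. of_bool (none T \<omega>))"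
      by (intro expectation_mult_Pi_pmf[where S = "S v" and T = "\<Union>w\<in>T. S w"]
          depends_on_compose[OF A[OF v]] depends_on_compose[OF none] I fin) auto
    then show ?thesis by (simp add: E of_bool_conj)
  qed
  have mono: "\<P> X \<le> \<P> Y" if "\<And>\<omega>. X \<omega> \<Longrightarrow> Y \<omega>" for X Y
    unfolding \<P>_def by (rule measure_pmf.finite_measure_mono) (use that in auto)
  have step: "\<P> (none (insert w T)) = \<P> (none T) - \<P> (\<lambda>\<omega>. A w \<omega> \<and> none T \<omega>)" for w T
  proof -
    have "{\<omega>. none (insert w T) \<omega>} = {\<omega>. none T \<omega>} - {\<omega>. A w \<omega> \<and> none T \<omega>}"
      by (auto simp: none_def)
    then show ?thesis unfolding \<P>_def
      by (simp only:) (subst measure_pmf.finite_measure_Diff, auto)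
  qed
  have union: "\<P> (none (T \<union> U)) \<ge> \<P> (none T) - (\<Sum>w\<in>U. \<P> (\<lambda>\<omega>. A w \<omega> \<and> none T \<omega>))"
    if "finite U" for T U
    using that
  proof (induction rule: finite_induct)
    case (insert w U)
    have "\<P> (\<lambda>\<omega>. A w \<omega> \<and> none (T \<union> U) \<omega>) \<le> \<P> (\<lambda>\<omega>. A w \<omega> \<and> none T \<omega>)"
      by (rule mono) (auto simp: none_def)
    then show ?case using insert step[of w "T \<union> U"] by simp
  qed simp
  have main: "\<P> (none T) > 0 \<and> (\<forall>v\<in>V. \<P> (\<lambda>\<omega>. A v \<omega> \<and> none T \<omega>) \<le> 2 * q * \<P> (none T))"
    if "finite T" "T \<subseteq> V" for T
    using that
  proof (induction rule: finite_psubset_induct)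
    case (psubset T)
    have pos: "\<P> (none T) > 0"
    proof (cases "T = {}")
      case True
      then show ?thesis by (simp add: none_def \<P>_def)
    next
      case False
      then obtain w where w: "w \<in> T" by blast
      have wV: "w \<in> V" using w psubset.prems by blast
      \<comment> \<open>Each vertex is counted as its own neighbour. Hence \<open>n \<ge> 1\<close>
        and \<open>q \<le> 1/4\<close>, and avoiding one more event costs at most half of the
        probability.\<close>
      have "card (N w) > 0"
        using V wV by (auto simp: N_def card_gt_0_iff)
      then have "n \<ge> 1" using n[OF wV] unfolding N_def by linarith
      then have "q \<le> 1 / 4"
        using qn q0[OF wV] mult_left_mono[of 1 n "4 * q"] by linarith
      moreover have IH: "\<P> (none (T - {w})) > 0"
        "\<P> (\<lambda>\<omega>. A w \<omega> \<and> none (T - {w}) \<omega>) \<le> 2 * q * \<P> (none (T - {w}))"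
        using psubset.IH[of "T - {w}"] w wV psubset.prems by auto
      ultimately have "2 * q * \<P> (none (T - {w})) \<le> 1 / 2 * \<P> (none (T - {w}))"
        by (intro mult_right_mono) auto
      moreover have "\<P> (none T) = \<P> (none (T - {w})) - \<P> (\<lambda>\<omega>. A w \<omega> \<and> none (T - {w}) \<omega>)"
        using step[of w "T - {w}"] w by (simp add: insert_absorb)
      ultimately show ?thesis using IH by linarith
    qed
    have "\<P> (\<lambda>\<omega>. A v \<omega> \<and> none T \<omega>) \<le> 2 * q * \<P> (none T)" if v: "v \<in> V" for v
    proof (cases "T \<inter> N v = {}")
      case True
      have "\<P> (\<lambda>\<omega>. A v \<omega> \<and> none T \<omega>) \<le> q * \<P> (none T)"
        unfolding indep[OF v psubset.prems True] using q[OF v] pos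
        by (intro mult_right_mono) (auto simp: \<P>_def)
      moreover have "q * \<P> (none T) \<ge> 0" using q0[OF v] pos by simp
      ultimately show ?thesis by linarith
    next
      case False
      \<comment> \<open>\<open>A v\<close> is independent of the events in \<open>T'\<close>. By
        induction, the at most \<open>n\<close> events in \<open>T \<inter> N v\<close> remove at
        most the fraction \<open>2 * q * n \<le> 1/2\<close> of the probability of
        \<open>none T'\<close>, which costs the factor 2 in the claim.\<close>
      define T' where "T' = T - N v"
      have T': "T' \<subset> T" "T' \<subseteq> V" using False psubset.prems by (auto simp: T'_def)
      note IH = psubset.IH[OF T']
      have "\<P> (\<lambda>\<omega>. A v \<omega> \<and> none T \<omega>) \<le> \<P> (\<lambda>\<omega>. A v \<omega> \<and> none T' \<omega>)"
        by (rule mono) (auto simp: none_def T'_def)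
      also have "\<dots> = \<P> (A v) * \<P> (none T')"
        by (rule indep[OF v T'(2)]) (auto simp: T'_def)
      also have "\<dots> \<le> q * \<P> (none T')"
        using q[OF v] IH by (intro mult_right_mono) (auto simp: \<P>_def)
      finally have 1: "\<P> (\<lambda>\<omega>. A v \<omega> \<and> none T \<omega>) \<le> q * \<P> (none T')" .
      have "(\<Sum>w\<in>T \<inter> N v. \<P> (\<lambda>\<omega>. A w \<omega> \<and> none T' \<omega>)) \<le>
            of_nat (card (T \<inter> N v)) * (2 * q * \<P> (none T'))"
        using IH psubset.prems by (intro sum_bounded_above) auto
      also have "\<dots> \<le> n * (2 * q * \<P> (none T'))"
      proof (rule mult_right_mono)
        have "card (T \<inter> N v) \<le> card (N v)"
          using V by (intro card_mono) (auto simp: N_def)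
        then show "real (card (T \<inter> N v)) \<le> n" using n[OF v] unfolding N_def by linarith
      qed (use IH q0[OF v] in auto)
      also have "\<dots> = (4 * q * n) * (\<P> (none T') / 2)" by simp
      also have "\<dots> \<le> 1 * (\<P> (none T') / 2)"
        using qn IH by (intro mult_right_mono) auto
      finally have "\<P> (none (T' \<union> (T \<inter> N v))) \<ge> \<P> (none T') / 2"
        using union[of "T \<inter> N v" T'] psubset.hyps by simp
      moreover have "T' \<union> (T \<inter> N v) = T" by (auto simp: T'_def)
      ultimately have "2 * \<P> (none T) \<ge> \<P> (none T')" by simp
      from mult_left_mono[OF this q0[OF v]] 1 show ?thesis by simp
    qed
    with pos show ?case by blast
  qed
  from main[of V] V have "\<P> (none V) > 0" by simp
  then have "set_pmf (Pi_pmf I d p) \<inter> {\<omega>. none V \<omega>} \<noteq> {}"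
    unfolding \<P>_def measure_pmf_zero_iff[symmetric] by auto
  then show ?thesis unfolding none_def by blast
qed

subsection \<open>Sparsification\<close>

text \<open>Edges form a set from here on: with \<open>r \<ge> 2\<close>, girth at least 4 excludes
  parallel edges.\<close>

definition star :: "'a set set \<Rightarrow> 'a \<Rightarrow> 'a set set" where
  "star E v = {e \<in> E. v \<in> e}"

lemma finite_star [simp]: "finite E \<Longrightarrow> finite (star E v)"
  by (simp add: star_def)

lemma card_Union_star_le:
  assumes E: "finite E" "\<forall>e\<in>E. finite e \<and> card e = r" and b: "real (card (star E v)) \<le> b"
  shows "real (card (\<Union>(star E v))) \<le> b * r"
proof -
  have "card (\<Union>(star E v)) \<le> (\<Sum>e\<in>star E v. card e)"
    by (rule card_Union_le_sum_card)
  also have "\<dots> = card (star E v) * r" using E by (simp add: star_def)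
  finally have "real (card (\<Union>(star E v))) \<le> real (card (star E v)) * r"
    by (metis of_nat_le_iff of_nat_mult)
  also have "\<dots> \<le> b * r" using b by (intro mult_right_mono) auto
  finally show ?thesis .
qed

text \<open>The number of kept edges at a vertex is binomial, so Hoeffding's inequality bounds a
  relative deviation. Events at two vertices share a coordinate only if the vertices lie on a common
  edge, which leaves at most \<open>b * r\<close> neighbours; hypothesis \<open>ab\<close> is then
  the condition of the local lemma.\<close>

lemma edge_sampling:
  assumes V: "finite V" and E: "finite E" "\<forall>e\<in>E. finite e \<and> card e = r"
    and deg: "\<And>v. v \<in> V \<Longrightarrow> a \<le> real (card (star E v)) \<and> real (card (star E v)) \<le> b"
    and a: "a > 0" and p: "0 \<le> p" "p \<le> 1" and \<gamma>: "\<gamma> \<ge> 0"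
    and ab: "8 * exp (- 2 * a * \<gamma>\<^sup>2) * (b * r) \<le> 1"
  shows "\<exists>F\<subseteq>E. \<forall>v\<in>V. \<bar>real (card (star F v)) - p * real (card (star E v))\<bar>
           \<le> \<gamma> * real (card (star E v))"
proof -
  define d where "d v = card (star E v)" for v
  define X where "X v \<omega> = card {e\<in>star E v. \<omega> e}" for v and \<omega> :: "'a set \<Rightarrow> bool"
  define A where "A v \<omega> \<longleftrightarrow> \<bar>real (X v \<omega>) / d v - p\<bar> \<ge> \<gamma>" for v \<omega>
  have d: "d v > 0" "a \<le> d v" if "v \<in> V" for v
    using deg[OF that] a by (auto simp: d_def)
  have "\<exists>\<omega>\<in>set_pmf (Pi_pmf E False (\<lambda>_. bernoulli_pmf p)). \<forall>v\<in>V. \<not> A v \<omega>"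
  proof (rule local_lemma_Pi_pmf[OF E(1) _ V])
    show "depends_on (A v) (star E v)" for v
    proof -
      have "A v \<omega> = A v \<omega>'" if "\<forall>i\<in>star E v. \<omega> i = \<omega>' i" for \<omega> \<omega>'
      proof -
        have "{e\<in>star E v. \<omega> e} = {e\<in>star E v. \<omega>' e}" using that by blast
        then show ?thesis by (simp add: A_def X_def)
      qed
      then show ?thesis unfolding depends_on_def by blast
    qed
    show "measure_pmf.prob (Pi_pmf E False (\<lambda>_. bernoulli_pmf p)) {\<omega>. A v \<omega>} \<le> 2 * exp (- 2 * a * \<gamma>\<^sup>2)"
      if v: "v \<in> V" for v
    proof -
      let ?P = "Pi_pmf E False (\<lambda>_. bernoulli_pmf p)"
      have "binomial_pmf (d v) p = map_pmf (\<lambda>f. card {e\<in>star E v. f e})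
              (Pi_pmf (star E v) False (\<lambda>_. bernoulli_pmf p))"
        using E p by (intro binomial_pmf_altdef') (auto simp: d_def)
      also have "Pi_pmf (star E v) False (\<lambda>_. bernoulli_pmf p) =
          map_pmf (\<lambda>f e. if e \<in> star E v then f e else False) ?P"
        using E by (intro Pi_pmf_subset) (auto simp: star_def)
      also have "map_pmf (\<lambda>f. card {e\<in>star E v. f e}) \<dots> = map_pmf (X v) ?P"
        by (simp add: map_pmf_comp X_def[abs_def] cong: conj_cong)
      finally have "measure_pmf.prob ?P {\<omega>. A v \<omega>} =
          measure_pmf.prob (binomial_pmf (d v) p) {x. \<bar>real x / d v - p\<bar> \<ge> \<gamma>}"
        by (simp add: A_def vimage_def)
      also have "\<dots> \<le> 2 * exp (- 2 * d v * \<gamma>\<^sup>2)"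
        using d[OF v] p \<gamma> by (intro binomial_distribution.prob_abs_ge') (auto simp: binomial_distribution_def)
      also have "\<dots> \<le> 2 * exp (- 2 * a * \<gamma>\<^sup>2)"
        using d[OF v] by (simp add: mult_right_mono)
      finally show ?thesis .
    qed
    show "real (card {w\<in>V. w = v \<or> star E w \<inter> star E v \<noteq> {}}) \<le> b * r" if v: "v \<in> V" for v
    proof -
      have "star E v \<noteq> {}" using d(1)[OF v] by (auto simp: d_def)
      then have "{w\<in>V. w = v \<or> star E w \<inter> star E v \<noteq> {}} \<subseteq> \<Union>(star E v)"
        by (auto simp: star_def)
      moreover have "finite (\<Union>(star E v))" using E by (auto simp: star_def)
      ultimately have "card {w\<in>V. w = v \<or> star E w \<inter> star E v \<noteq> {}} \<le> card (\<Union>(star E v))"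
        by (rule card_mono[rotated])
      then show ?thesis using card_Union_star_le[OF E, of v b] deg[OF v] by linarith
    qed
    show "4 * (2 * exp (- 2 * a * \<gamma>\<^sup>2)) * (b * r) \<le> 1" using ab by simp
  qed auto
  then obtain \<omega> where \<omega>: "\<And>v. v \<in> V \<Longrightarrow> \<not> A v \<omega>" by blast
  show ?thesis
  proof (intro exI[of _ "{e\<in>E. \<omega> e}"] conjI ballI)
    fix v assume v: "v \<in> V"
    have "star {e\<in>E. \<omega> e} v = {e\<in>star E v. \<omega> e}" by (auto simp: star_def)
    then have "real (card (star {e\<in>E. \<omega> e} v)) - p * d v = d v * (real (X v \<omega>) / d v - p)"
      using d(1)[OF v] by (simp add: X_def field_simps)
    then have "\<bar>real (card (star {e\<in>E. \<omega> e} v)) - p * d v\<bar> = d v * \<bar>real (X v \<omega>) / d v - p\<bar>"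
      by (simp add: abs_mult)
    also have "\<dots> \<le> d v * \<gamma>"
      using \<omega>[OF v] by (intro mult_left_mono) (auto simp: A_def)
    finally show "\<bar>real (card (star {e\<in>E. \<omega> e} v)) - p * real (card (star E v))\<bar>
        \<le> \<gamma> * real (card (star E v))"
      by (simp add: d_def mult.commute)
  qed auto
qed

lemma sparsify_step:
  fixes s \<mu> :: real
  assumes V: "finite V" and E: "finite E" "\<forall>e\<in>E. finite e \<and> card e = r"
    and s: "s \<ge> 2" and \<mu>: "\<mu> \<ge> 1"
    and deg: "\<And>v. v \<in> V \<Longrightarrow> s^4 - s^3 \<le> real (card (star E v)) \<and> real (card (star E v)) \<le> \<mu> * (s^4 + s^3)"
    and large: "16 * \<mu> * r * s^4 \<le> exp (s\<^sup>2 / 1024)"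
  shows "\<exists>F\<subseteq>E. \<forall>v\<in>V. (s/2)^4 - (s/2)^3 \<le> real (card (star F v)) \<and>
           real (card (star F v)) \<le> \<mu> * ((s/2)^4 + (s/2)^3)"
proof -
  \<comment> \<open>The deviation is then at most \<open>s^3/32 + s^2/32 \<le> s^3/16\<close>, up to
    the factor \<mu> at the upper end, and \<open>s^4 * \<gamma>\<^sup>2 = s\<^sup>2/1024\<close> is
    the exponent in \<open>large\<close>.\<close>
  define \<gamma> where "\<gamma> = 1 / (32 * s)"
  have s3: "2 * s^3 \<le> s^4"
    using mult_right_mono[OF s, of "s^3"] s by (simp add: power_eq_if)
  have "2 * (s^4 - s^3) * \<gamma>\<^sup>2 \<ge> s^4 * \<gamma>\<^sup>2"
    using s3 by (intro mult_right_mono) auto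
  also have "s^4 * \<gamma>\<^sup>2 = s\<^sup>2 / 1024"
    using s by (simp add: \<gamma>_def power_divide power_mult_distrib power_eq_if)
  finally have "exp (- 2 * (s^4 - s^3) * \<gamma>\<^sup>2) \<le> exp (- (s\<^sup>2 / 1024))"
    unfolding exp_le_cancel_iff by linarith
  then have "8 * exp (- 2 * (s^4 - s^3) * \<gamma>\<^sup>2) * (\<mu> * (s^4 + s^3) * r) \<le>
             8 * exp (- (s\<^sup>2 / 1024)) * (\<mu> * (2 * s^4) * r)"
    using s3 s \<mu> by (intro mult_mono mult_left_mono mult_right_mono) auto
  also have "\<dots> = (16 * \<mu> * r * s^4) * exp (- (s\<^sup>2 / 1024))" by simp
  also have "\<dots> \<le> exp (s\<^sup>2 / 1024) * exp (- (s\<^sup>2 / 1024))"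
    using large by (intro mult_right_mono) auto
  also have "\<dots> = 1" by (simp flip: exp_add)
  finally have ab: "8 * exp (- 2 * (s^4 - s^3) * \<gamma>\<^sup>2) * (\<mu> * (s^4 + s^3) * r) \<le> 1" .
  have "s^4 - s^3 > 0" using s3 s zero_less_power[of s 3] by linarith
  with edge_sampling[OF V E deg, of "1/16" \<gamma>] ab s obtain F where "F \<subseteq> E"
    and F: "\<And>v. v \<in> V \<Longrightarrow> \<bar>real (card (star F v)) - 1/16 * real (card (star E v))\<bar>
              \<le> \<gamma> * real (card (star E v))"
    by (auto simp: \<gamma>_def)
  have "(s/2)^4 - (s/2)^3 \<le> real (card (star F v)) \<and>
        real (card (star F v)) \<le> \<mu> * ((s/2)^4 + (s/2)^3)" if v: "v \<in> V" for v
  proof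
    have g: "\<gamma> \<le> 1/16" "\<gamma> \<ge> 0" using s by (auto simp: \<gamma>_def field_simps)
    have gs: "\<gamma> * s^4 = s^3 / 32" "\<gamma> * s^3 = s^2 / 32"
      using s by (auto simp: \<gamma>_def power_eq_if)
    have s2: "s^2 \<le> s^3" using s by (intro power_increasing) auto
    have "(1/16 - \<gamma>) * (s^4 - s^3) \<le> (1/16 - \<gamma>) * real (card (star E v))"
      using deg[OF v] g by (intro mult_left_mono) auto
    also have "\<dots> \<le> real (card (star F v))" using F[OF v] by (simp add: algebra_simps)
    finally have "s^4/16 - s^3/16 - \<gamma> * s^4 + \<gamma> * s^3 \<le> real (card (star F v))"
      by (simp add: algebra_simps)
    moreover have "s^2 \<ge> 0" "s^3 \<ge> 0" using s by auto
    moreover have "(s/2)^4 - (s/2)^3 = s^4/16 - s^3/8" by (simp add: power_divide)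
    ultimately show "(s/2)^4 - (s/2)^3 \<le> real (card (star F v))"
      unfolding gs by linarith
    have "real (card (star F v)) \<le> (1/16 + \<gamma>) * real (card (star E v))"
      using F[OF v] by (simp add: algebra_simps)
    also have "\<dots> \<le> (1/16 + \<gamma>) * (\<mu> * (s^4 + s^3))"
      using deg[OF v] g by (intro mult_left_mono) auto
    also have "\<dots> = \<mu> * (s^4/16 + s^3/16 + \<gamma> * s^4 + \<gamma> * s^3)" by (simp add: algebra_simps)
    also have "\<dots> \<le> \<mu> * ((s/2)^4 + (s/2)^3)"
      unfolding gs power_divide using \<mu> s2 by (intro mult_left_mono) auto
    finally show "real (card (star F v)) \<le> \<mu> * ((s/2)^4 + (s/2)^3)" .
  qed
  with \<open>F \<subseteq> E\<close> show ?thesis by blast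
qed

text \<open>The induction is on a bound \<open>k\<close> for the number of halvings. Only an
  \<open>s\<close> of at least \<open>2 * s0\<close> is halved, so the parameter stays in the range
  where \<open>large\<close> holds.\<close>

lemma sparsify_iterate:
  fixes s s0 \<mu> :: real
  assumes V: "finite V" and E: "finite E" "\<forall>e\<in>E. finite e \<and> card e = r"
    and s: "s0 \<ge> 2" "s \<ge> s0" "s < 2^k * s0" and \<mu>: "\<mu> \<ge> 1"
    and deg: "\<And>v. v \<in> V \<Longrightarrow> s^4 - s^3 \<le> real (card (star E v)) \<and> real (card (star E v)) \<le> \<mu> * (s^4 + s^3)"
    and large: "\<And>s. s \<ge> s0 \<Longrightarrow> 16 * \<mu> * r * s^4 \<le> exp (s\<^sup>2 / 1024)"
  shows "\<exists>F\<subseteq>E. \<exists>\<sigma>. s0 \<le> \<sigma> \<and> \<sigma> < 2 * s0 \<and> (\<forall>v\<in>V. \<sigma>^4 - \<sigma>^3 \<le> real (card (star F v)) \<and>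
           real (card (star F v)) \<le> \<mu> * (\<sigma>^4 + \<sigma>^3))"
  using E s(2,3) deg
proof (induction k arbitrary: E s)
  case 0
  then show ?case by simp
next
  case (Suc k E s)
  show ?case
  proof (cases "s < 2 * s0")
    case True
    then show ?thesis using Suc.prems by blast
  next
    case False
    have "\<exists>F\<subseteq>E. \<forall>v\<in>V. (s/2)^4 - (s/2)^3 \<le> real (card (star F v)) \<and>
           real (card (star F v)) \<le> \<mu> * ((s/2)^4 + (s/2)^3)"
      using Suc.prems s(1) \<mu> by (intro sparsify_step[OF V, where r = r] large) auto
    then obtain F where F: "F \<subseteq> E" "\<forall>v\<in>V. (s/2)^4 - (s/2)^3 \<le> real (card (star F v)) \<and>
           real (card (star F v)) \<le> \<mu> * ((s/2)^4 + (s/2)^3)" by blast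
    moreover have "finite F" using F Suc.prems(1) finite_subset by blast
    ultimately have "\<exists>F'\<subseteq>F. \<exists>\<sigma>. s0 \<le> \<sigma> \<and> \<sigma> < 2 * s0 \<and> (\<forall>v\<in>V. \<sigma>^4 - \<sigma>^3 \<le> real (card (star F' v)) \<and>
           real (card (star F' v)) \<le> \<mu> * (\<sigma>^4 + \<sigma>^3))"
      using Suc.prems(2,4) False by (intro Suc.IH[of F "s/2"]) auto
    then show ?thesis using F(1) by (meson order_trans)
  qed
qed

text \<open>At the final \<sigma> the ends of the degree window have ratio
  \<open>\<mu> * (\<sigma> + 1) / (\<sigma> - 1)\<close>, which is within a factor
  \<open>1 + 4 / s0\<close> of \<mu> because \<open>\<sigma> \<ge> s0 \<ge> 2\<close>. If \<delta>
  is already below \<open>s0^4\<close>, all edges are kept.\<close>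

lemma sparsify:
  fixes s0 \<mu> \<delta> :: real
  assumes V: "finite V" and E: "finite E" "\<forall>e\<in>E. finite e \<and> card e = r"
    and s0: "s0 \<ge> 2" and \<mu>: "\<mu> \<ge> 1" and \<delta>: "\<delta> > 0"
    and deg: "\<And>v. v \<in> V \<Longrightarrow> \<delta> \<le> real (card (star E v)) \<and> real (card (star E v)) \<le> \<mu> * \<delta>"
    and large: "\<And>s. s \<ge> s0 \<Longrightarrow> 16 * \<mu> * r * s^4 \<le> exp (s\<^sup>2 / 1024)"
  shows "\<exists>F\<subseteq>E. \<exists>a>0. a \<le> 16 * s0^4 \<and> (\<forall>v\<in>V. a \<le> real (card (star F v)) \<and>
           real (card (star F v)) \<le> (1 + 4 / s0) * \<mu> * a)"
proof (cases "\<delta> < s0^4")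
  case True
  show ?thesis
  proof (intro exI[of _ E] exI[of _ \<delta>] conjI ballI)
    fix v assume v: "v \<in> V"
    have "\<mu> * \<delta> \<le> (1 + 4 / s0) * (\<mu> * \<delta>)"
      using s0 \<mu> \<delta> mult_right_mono[of 1 "1 + 4 / s0" "\<mu> * \<delta>"] by simp
    then show "real (card (star E v)) \<le> (1 + 4 / s0) * \<mu> * \<delta>" using deg[OF v] by simp
  qed (use True deg \<delta> in auto)
next
  case False
  define s where "s = root 4 \<delta>"
  have s: "s^4 = \<delta>" "s \<ge> s0"
    using False \<delta> s0 real_root_le_mono[of 4 "s0^4" \<delta>] real_root_power_cancel[of 4 s0]
    by (auto simp: s_def)
  have s3: "s^3 \<ge> 0" using s s0 by simp
  obtain k where "s / s0 < 2^k" using real_arch_pow[of 2 "s / s0"] by auto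
  then have k: "s < 2^k * s0" using s0 by (simp add: field_simps)
  have "s^4 - s^3 \<le> real (card (star E v)) \<and> real (card (star E v)) \<le> \<mu> * (s^4 + s^3)"
    if "v \<in> V" for v
  proof -
    have "\<mu> * s^3 \<ge> 0" using s3 \<mu> by simp
    then show ?thesis using deg[OF that] s3 unfolding s(1) distrib_left by linarith
  qed
  from sparsify_iterate[OF V E s0 s(2) k \<mu> this large] obtain F \<sigma> where F: "F \<subseteq> E"
    and \<sigma>: "s0 \<le> \<sigma>" "\<sigma> < 2 * s0"
    and dF: "\<And>v. v \<in> V \<Longrightarrow> \<sigma>^4 - \<sigma>^3 \<le> real (card (star F v)) \<and>
           real (card (star F v)) \<le> \<mu> * (\<sigma>^4 + \<sigma>^3)"
    by blast
  have \<sigma>3: "\<sigma>^3 > 0" using \<sigma> s0 by simp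
  have \<sigma>4: "\<sigma>^4 = \<sigma> * \<sigma>^3" by (simp add: power_eq_if)
  have "\<sigma>^4 \<le> (2 * s0)^4" using \<sigma> s0 by (intro power_mono) auto
  moreover have "(2 * s0)^4 = 16 * s0^4" by (simp add: power_mult_distrib)
  ultimately have le: "\<sigma>^4 - \<sigma>^3 \<le> 16 * s0^4" using \<sigma>3 by linarith
  have "1 * (\<sigma> - 1) \<le> 4 / s0 * (\<sigma> - 1) + (\<sigma> - 1) - 2"
  proof -
    have "2 * s0 \<le> 4 * \<sigma> - 4" using \<sigma>(1) s0 by simp
    then have "2 \<le> 4 / s0 * (\<sigma> - 1)" using s0 by (simp add: field_simps)
    then show ?thesis by simp
  qed
  then have "\<sigma> + 1 \<le> (1 + 4 / s0) * (\<sigma> - 1)" by (simp add: distrib_right)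
  then have "(\<sigma> + 1) * \<sigma>^3 \<le> ((1 + 4 / s0) * (\<sigma> - 1)) * \<sigma>^3"
    using \<sigma>3 by (intro mult_right_mono) auto
  then have ratio: "\<sigma>^4 + \<sigma>^3 \<le> (1 + 4 / s0) * (\<sigma>^4 - \<sigma>^3)"
    by (simp only: \<sigma>4 mult.assoc left_diff_distrib distrib_right mult_1_left)
  show ?thesis
  proof (intro exI[of _ F] exI[of _ "\<sigma>^4 - \<sigma>^3"] conjI ballI)
    show "\<sigma>^4 - \<sigma>^3 > 0" using \<sigma>3 \<sigma> s0 by (simp add: \<sigma>4)
    fix v assume v: "v \<in> V"
    have "\<mu> * (\<sigma>^4 + \<sigma>^3) \<le> \<mu> * ((1 + 4 / s0) * (\<sigma>^4 - \<sigma>^3))"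
      using ratio \<mu> by (intro mult_left_mono) auto
    then show "real (card (star F v)) \<le> (1 + 4 / s0) * \<mu> * (\<sigma>^4 - \<sigma>^3)"
      using dF[OF v] by (simp add: mult_ac)
  qed (use F le dF in auto)
qed

subsection \<open>Sampling with alteration\<close>

text \<open>Markov's inequality for \<open>x\<close> to the number of events that occur: the
  expectation factors over the disjoint blocks, each factor being at most
  \<open>1 + q * (x - 1)\<close>. The base \<open>x\<close> stays free, since the two ranges of
  \<mu> use different ones.\<close>

lemma chernoff_blocks_Pi_pmf:
  fixes X :: "'k \<Rightarrow> ('i \<Rightarrow> 'b) \<Rightarrow> bool"
  assumes I: "finite I" and fin: "\<And>i. i \<in> I \<Longrightarrow> finite (set_pmf (p i))"
    and K: "finite K" and dep: "\<And>k. k \<in> K \<Longrightarrow> depends_on (X k) (S k)"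
    and disj: "\<And>k l. k \<in> K \<Longrightarrow> l \<in> K \<Longrightarrow> k \<noteq> l \<Longrightarrow> S k \<inter> S l = {}"
    and q: "\<And>k. k \<in> K \<Longrightarrow> measure_pmf.prob (Pi_pmf I d p) {\<omega>. X k \<omega>} \<le> q"
    and x: "x \<ge> 1"
  shows "measure_pmf.prob (Pi_pmf I d p) {\<omega>. real (card {k\<in>K. X k \<omega>}) > t}
           \<le> exp (real (card K) * q * (x - 1)) / x powr t"
proof -
  let ?P = "Pi_pmf I d p"
  have int: "integrable (measure_pmf ?P) f" for f :: "('i \<Rightarrow> 'b) \<Rightarrow> real"
    by (intro integrable_measure_pmf_finite finite_set_Pi_pmf I fin)
  define Y :: "'k \<Rightarrow> ('i \<Rightarrow> 'b) \<Rightarrow> real" where "Y k \<omega> = (if X k \<omega> then x else 1)" for k \<omega>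
  have Y: "(\<Prod>k\<in>K. Y k \<omega>) = x ^ card {k\<in>K. X k \<omega>}" for \<omega>
    using K unfolding Y_def by (simp add: prod.If_cases Int_def)
  have EY: "measure_pmf.expectation ?P (Y k) \<le> exp (q * (x - 1))" if k: "k \<in> K" for k
  proof -
    have "Y k = (\<lambda>\<omega>. 1 + (x - 1) * indicator {\<omega>. X k \<omega>} \<omega>)"
      by (auto simp: Y_def indicator_def)
    then have "measure_pmf.expectation ?P (Y k) = 1 + (x - 1) * measure_pmf.prob ?P {\<omega>. X k \<omega>}"
      by (simp add: int)
    also have "\<dots> \<le> 1 + (x - 1) * q" using q[OF k] x by (intro add_left_mono mult_left_mono) auto
    also have "\<dots> \<le> exp (q * (x - 1))" using exp_ge_add_one_self[of "q * (x - 1)"] by (simp add: mult.commute)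
    finally show ?thesis .
  qed
  have "measure_pmf.prob ?P {\<omega>. real (card {k\<in>K. X k \<omega>}) > t} =
        measure_pmf.expectation ?P (indicator {\<omega>. real (card {k\<in>K. X k \<omega>}) > t})"
    by simp
  also have "\<dots> \<le> measure_pmf.expectation ?P (\<lambda>\<omega>. (\<Prod>k\<in>K. Y k \<omega>) / x powr t)"
  proof (rule integral_mono[OF int int])
    fix \<omega>
    show "indicator {\<omega>. real (card {k\<in>K. X k \<omega>}) > t} \<omega> \<le> (\<Prod>k\<in>K. Y k \<omega>) / x powr t"
    proof (cases "real (card {k\<in>K. X k \<omega>}) > t")
      case True
      then have "x powr t \<le> x powr card {k\<in>K. X k \<omega>}" using x by (intro powr_mono) auto
      then show ?thesis using True x by (simp add: Y powr_realpow)
    next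
      case False
      then show ?thesis using x by (simp add: Y)
    qed
  qed
  also have "\<dots> = (\<Prod>k\<in>K. measure_pmf.expectation ?P (Y k)) / x powr t"
  proof -
    have "measure_pmf.expectation ?P (\<lambda>\<omega>. \<Prod>k\<in>K. Y k \<omega>) = (\<Prod>k\<in>K. measure_pmf.expectation ?P (Y k))"
      using disj unfolding Y_def
      by (intro expectation_prod_blocks_Pi_pmf[where S = S, OF I fin K]
          depends_on_compose[OF dep, where h = "\<lambda>b. if b then x else 1"]) auto
    then show ?thesis by simp
  qed
  also have "\<dots> \<le> (\<Prod>k\<in>K. exp (q * (x - 1))) / x powr t"
    using EY x by (intro divide_right_mono prod_mono conjI integral_nonneg_AE) (auto simp: Y_def)
  finally show ?thesis by (simp add: exp_of_nat_mult mult.assoc)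
qed

lemma card_UN_le_real:
  assumes "finite A" "real (card A) \<le> m" "\<And>x. x \<in> A \<Longrightarrow> real (card (B x)) \<le> n" "n \<ge> 0"
  shows "real (card (\<Union>x\<in>A. B x)) \<le> m * n"
proof -
  have "real (card (\<Union>x\<in>A. B x)) \<le> real (\<Sum>x\<in>A. card (B x))"
    using card_UN_le[OF assms(1)] by (simp only: of_nat_le_iff)
  also have "\<dots> \<le> of_nat (card A) * n"
    unfolding of_nat_sum using assms(3) by (rule sum_bounded_above)
  also have "\<dots> \<le> m * n" using assms(2,4) by (rule mult_right_mono)
  finally show ?thesis .
qed

text \<open>Girth at least 4 in the form in which it is used: no cycle of length 2 and none of
  length 3. Both conditions pass to subsets of the edges, as sparsification requires.\<close>

locale linear_triangle_free =
  fixes V :: "'a set" and E :: "'a set set" and r :: nat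
  assumes finV: "finite V" and r: "r \<ge> 2"
    and edge: "\<And>e. e \<in> E \<Longrightarrow> e \<subseteq> V \<and> card e = r"
    and linear: "\<And>e f u v. e \<in> E \<Longrightarrow> f \<in> E \<Longrightarrow> {u, v} \<subseteq> e \<Longrightarrow> {u, v} \<subseteq> f \<Longrightarrow> u \<noteq> v \<Longrightarrow> e = f"
    and triangle_free: "\<And>e f g u v w. {e, f, g} \<subseteq> E \<Longrightarrow> {u, v} \<subseteq> e \<Longrightarrow> {v, w} \<subseteq> f \<Longrightarrow> {w, u} \<subseteq> g \<Longrightarrow>
        distinct [u, v, w] \<Longrightarrow> \<not> distinct [e, f, g]"
begin

lemma finE: "finite E"
proof (rule finite_subset)
  show "E \<subseteq> Pow V" using edge by blast
qed (use finV in simp)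

lemma edge_finite: "e \<in> E \<Longrightarrow> finite e \<and> card e = r"
  using edge finV finite_subset by blast

lemma sub_hypergraph: "F \<subseteq> E \<Longrightarrow> linear_triangle_free V F r"
proof
  fix e f g u v w assume "F \<subseteq> E" "{e, f, g} \<subseteq> F" "{u, v} \<subseteq> e" "{v, w} \<subseteq> f" "{w, u} \<subseteq> g" "distinct [u, v, w]"
  then show "\<not> distinct [e, f, g]" by (intro triangle_free[of e f g u v w]) auto
next
  fix e f u v assume "F \<subseteq> E" "e \<in> F" "f \<in> F" "{u, v} \<subseteq> e" "{u, v} \<subseteq> f" "u \<noteq> v"
  then show "e = f" by (intro linear[of e f u v]) auto
qed (use finV r edge in auto)

text \<open>An edge that meets both \<open>e - {v}\<close> and \<open>f - {v}\<close> would close a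
  triangle with \<open>e\<close> and \<open>f\<close>, unless two of the three edges share two
  vertices, which linearity forbids.\<close>

lemma two_step_stars_disjoint:
  assumes "e \<in> star E v" "f \<in> star E v" "e \<noteq> f"
  shows "(\<Union>u\<in>e - {v}. star E u) \<inter> (\<Union>u\<in>f - {v}. star E u) = {}"
proof (rule ccontr)
  assume "\<not> ?thesis"
  then obtain g u w where g: "g \<in> E" "u \<in> e" "u \<noteq> v" "u \<in> g" "w \<in> f" "w \<noteq> v" "w \<in> g"
    by (auto simp: star_def)
  have ef: "e \<in> E" "f \<in> E" "v \<in> e" "v \<in> f" using assms by (auto simp: star_def)
  have "u \<noteq> w" using linear[of e f u v] g ef assms(3) by auto
  have "g \<noteq> e" using linear[of e f w v] g ef assms(3) by auto
  have "g \<noteq> f" using linear[of e f u v] g ef assms(3) by auto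
  show False
    using triangle_free[of e g f v u w] g ef assms(3) \<open>u \<noteq> w\<close> \<open>g \<noteq> e\<close> \<open>g \<noteq> f\<close> by auto
qed

text \<open>Every edge is sampled with probability \<open>ln r / a\<close>, and every vertex that is then missed takes a
  uniformly random edge. Coordinate \<open>Inl e\<close> is \<open>e\<close> if \<open>e\<close> is sampled and empty
  otherwise; coordinate \<open>Inr u\<close> is the edge that \<open>u\<close> takes if it is missed. By
  \<open>two_step_stars_disjoint\<close>, distinct edges at \<open>v\<close> are chosen, up to the choice of \<open>v\<close> itself, by
  independent events.\<close>

lemma shallow_hitting_if_chernoff:
  fixes a \<kappa> t x :: real
  assumes deg: "\<And>v. v \<in> V \<Longrightarrow> a \<le> real (card (star E v)) \<and> real (card (star E v)) \<le> \<kappa> * a"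
    and a: "ln r < a" and x: "x \<ge> 1"
    and ineq: "4 * exp (\<kappa> * (ln r + (1 - 1 / r)) * (x - 1)) * x * (\<kappa> * a * r)^3 \<le> x powr t"
  shows "\<exists>M\<subseteq>E. \<forall>v\<in>V. star M v \<noteq> {} \<and> real (card (star M v)) \<le> t"
proof -
  have lnr: "ln r > 0" and a0: "a > 0" using r a by (auto intro: less_trans[of 0 "ln r" a])
  define p where "p = ln r / a"
  have p: "0 \<le> p" "p \<le> 1" using a lnr a0 by (auto simp: p_def)
  define I :: "('a set + 'a) set" where "I = Inl ` E \<union> Inr ` V"
  define D :: "'a set + 'a \<Rightarrow> 'a set pmf" where
    "D i = (case i of Inl e \<Rightarrow> map_pmf (\<lambda>b. if b then e else {}) (bernoulli_pmf p)
            | Inr u \<Rightarrow> pmf_of_set (star E u))" for i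
  define P where "P = Pi_pmf I {} D"
  define missed where "missed u \<omega> \<longleftrightarrow> (\<forall>e\<in>star E u. \<omega> (Inl e) \<noteq> e)" for u and \<omega> :: "'a set + 'a \<Rightarrow> 'a set"
  \<comment> \<open>The choice of \<open>v\<close> itself is left out: \<open>missed v\<close> reads
    every edge at \<open>v\<close> and would couple all these events. It adds at most one edge,
    hence the threshold \<open>t - 1\<close> in \<open>bad\<close>.\<close>
  define X where "X v e \<omega> \<longleftrightarrow> \<omega> (Inl e) = e \<or> (\<exists>u\<in>e - {v}. missed u \<omega> \<and> \<omega> (Inr u) = e)" for v e \<omega>
  define S :: "'a \<Rightarrow> 'a set \<Rightarrow> ('a set + 'a) set" where
    "S v e = Inl ` (\<Union>u\<in>e - {v}. star E u) \<union> Inr ` (e - {v})" for v e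
  define bad where "bad v \<omega> \<longleftrightarrow> real (card {e\<in>star E v. X v e \<omega>}) > t - 1" for v \<omega>
  have star_ne: "star E v \<noteq> {}" if "v \<in> V" for v using deg[OF that] a0 by auto
  have I: "finite I" using finV finE by (simp add: I_def)
  have finD: "finite (set_pmf (D i))" if "i \<in> I" for i
    using that star_ne finE by (auto simp: I_def D_def)
  have e_ne: "e \<noteq> {}" if "e \<in> E" for e using edge[OF that] r by auto
  have depX: "depends_on (X v e) (S v e)" if "e \<in> star E v" for v e
    unfolding depends_on_def
  proof (intro allI impI)
    fix \<omega> \<omega>' :: "'a set + 'a \<Rightarrow> 'a set" assume eq: "\<forall>i\<in>S v e. \<omega> i = \<omega>' i"
    have e: "e \<in> E" "v \<in> e" using that by (auto simp: star_def)
    \<comment> \<open>\<open>r \<ge> 2\<close> gives another vertex \<open>u\<close> of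
      \<open>e\<close>, whose star contains \<open>e\<close>; thus \<open>S v e\<close> covers the
      coordinate \<open>Inl e\<close> without listing it separately.\<close>
    have "card (e - {v}) \<noteq> 0" using edge_finite[OF e(1)] e r by simp
    then have "e - {v} \<noteq> {}" by (metis card.empty)
    then obtain u where u: "u \<in> e - {v}" by blast
    then have "Inl e \<in> S v e" using e by (auto simp: S_def star_def)
    have eqI: "\<omega> i = \<omega>' i" if "i \<in> S v e" for i
      by (rule bspec[OF eq that])
    have missed: "missed u \<omega> \<longleftrightarrow> missed u \<omega>'" if "u \<in> e - {v}" for u
    proof -
      have "\<omega> (Inl f) = \<omega>' (Inl f)" if "f \<in> star E u" for f
        by (rule eqI) (use that \<open>u \<in> e - {v}\<close> in \<open>auto simp: S_def\<close>)
      then show ?thesis by (simp add: missed_def)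
    qed
    have "\<omega> (Inr u) = \<omega>' (Inr u)" if "u \<in> e - {v}" for u
      by (rule eqI) (use that in \<open>auto simp: S_def\<close>)
    then show "X v e \<omega> = X v e \<omega>'"
      unfolding X_def using missed eqI[OF \<open>Inl e \<in> S v e\<close>] by simp
  qed
  have disjS: "S v e \<inter> S v f = {}" if "e \<in> star E v" "f \<in> star E v" "e \<noteq> f" for v e f
  proof -
    have "(e - {v}) \<inter> (f - {v}) = {}"
      using linear[of e f v] that by (auto simp: star_def)
    then show ?thesis using two_step_stars_disjoint[OF that] by (auto simp: S_def)
  qed
  have prob_sampled: "measure_pmf.prob P {\<omega>. \<omega> (Inl e) = e} = p" if e: "e \<in> E" for e
  proof -
    have "measure_pmf.prob P {\<omega>. \<omega> (Inl e) = e} = measure_pmf.prob (map_pmf (\<lambda>\<omega>. \<omega> (Inl e)) P) {e}"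
      by (simp add: vimage_def)
    also have "map_pmf (\<lambda>\<omega>. \<omega> (Inl e)) P = D (Inl e)"
      using e I by (simp add: P_def Pi_pmf_component I_def)
    also have "measure_pmf.prob (D (Inl e)) {e} = measure_pmf.prob (bernoulli_pmf p) {True}"
      using e_ne[OF e] by (auto simp: D_def vimage_def intro!: arg_cong[where f = "measure_pmf.prob _"])
    also have "\<dots> = p" using p by (simp add: measure_pmf_single)
    finally show ?thesis .
  qed
  have prob_taken: "measure_pmf.prob P {\<omega>. missed u \<omega> \<and> \<omega> (Inr u) = e} \<le> 1 / (r * a)"
    if e: "e \<in> E" and u: "u \<in> e" for e u
  proof -
    have uV: "u \<in> V" using edge[OF e] u by blast
    \<comment> \<open>The event is a box: it restricts each coordinate separately, so its
      probability is a product.\<close>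
    define B :: "'a set + 'a \<Rightarrow> 'a set set" where
      "B i = (case i of Inl f \<Rightarrow> (if f \<in> star E u then - {f} else UNIV) | Inr w \<Rightarrow> (if w = u then {e} else UNIV))" for i
    have "{\<omega>. missed u \<omega> \<and> \<omega> (Inr u) = e} = Pi I B"
      using uV by (auto simp: missed_def B_def I_def Pi_def star_def split: sum.splits)
    then have "measure_pmf.prob P {\<omega>. missed u \<omega> \<and> \<omega> (Inr u) = e} = (\<Prod>i\<in>I. measure_pmf.prob (D i) (B i))"
      unfolding P_def by (simp add: measure_Pi_pmf_Pi I)
    also have "\<dots> = (\<Prod>f\<in>E. measure_pmf.prob (D (Inl f)) (B (Inl f))) *
                    (\<Prod>w\<in>V. measure_pmf.prob (D (Inr w)) (B (Inr w)))"
      unfolding I_def using finE finV by (subst prod.union_disjoint) (auto simp: prod.reindex)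
    also have "(\<Prod>f\<in>E. measure_pmf.prob (D (Inl f)) (B (Inl f))) = (\<Prod>f\<in>E. if f \<in> star E u then 1 - p else 1)"
    proof (rule prod.cong)
      fix f assume f: "f \<in> E"
      have "measure_pmf.prob (D (Inl f)) (- {f}) = measure_pmf.prob (bernoulli_pmf p) {False}"
        using e_ne[OF f] by (auto simp: D_def vimage_def intro!: arg_cong[where f = "measure_pmf.prob _"])
      then show "measure_pmf.prob (D (Inl f)) (B (Inl f)) = (if f \<in> star E u then 1 - p else 1)"
        using p by (simp add: B_def measure_pmf_single)
    qed simp
    also have "\<dots> = (1 - p) ^ card (star E u)"
    proof -
      have "E \<inter> {f. f \<in> star E u} = star E u" by (auto simp: star_def)
      then show ?thesis using finE by (simp add: prod.If_cases)
    qed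
    also have "(\<Prod>w\<in>V. measure_pmf.prob (D (Inr w)) (B (Inr w))) = (\<Prod>w\<in>V. if w = u then 1 / card (star E u) else 1)"
      using star_ne[OF uV] finE e u
      by (intro prod.cong) (auto simp: D_def B_def measure_pmf_single star_def)
    also have "\<dots> = 1 / card (star E u)" using uV finV by simp
    also have "(1 - p) ^ card (star E u) * (1 / card (star E u)) \<le> (1 / r) * (1 / a)"
    proof (intro mult_mono)
      have "(1 - p) ^ card (star E u) \<le> exp (- p) ^ card (star E u)"
        using p exp_ge_add_one_self[of "- p"] by (intro power_mono) auto
      also have "\<dots> = exp (- (p * card (star E u)))" by (simp flip: exp_of_nat_mult add: mult.commute)
      also have "\<dots> \<le> exp (- (p * a))" using deg[OF uV] p by (simp add: mult_left_mono)
      also have "\<dots> = 1 / r" using a0 r by (simp add: p_def exp_minus inverse_eq_divide)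
      finally show "(1 - p) ^ card (star E u) \<le> 1 / r" .
      show "1 / real (card (star E u)) \<le> 1 / a" using deg[OF uV] a0 by (intro divide_left_mono) auto
    qed auto
    finally show ?thesis by simp
  qed
  \<comment> \<open>Sampling contributes \<open>ln r / a\<close>, and each of the
    \<open>r - 1\<close> vertices of the edge other than \<open>v\<close> contributes at most
    \<open>1 / (r * a)\<close>.\<close>
  define q where "q = (ln r + (1 - 1 / r)) / a"
  have probX: "measure_pmf.prob P {\<omega>. X v e \<omega>} \<le> q" if e: "e \<in> star E v" for v e
  proof -
    have eE: "e \<in> E" and ve: "v \<in> e" using e by (auto simp: star_def)
    have fe: "finite e" "card (e - {v}) = r - 1" using edge_finite[OF eE] ve by auto
    have "{\<omega>. X v e \<omega>} = {\<omega>. \<omega> (Inl e) = e} \<union> (\<Union>u\<in>e - {v}. {\<omega>. missed u \<omega> \<and> \<omega> (Inr u) = e})"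
      by (auto simp: X_def)
    also have "measure_pmf.prob P \<dots> \<le> measure_pmf.prob P {\<omega>. \<omega> (Inl e) = e} +
        measure_pmf.prob P (\<Union>u\<in>e - {v}. {\<omega>. missed u \<omega> \<and> \<omega> (Inr u) = e})"
      by (rule measure_Un_le) auto
    also have "measure_pmf.prob P (\<Union>u\<in>e - {v}. {\<omega>. missed u \<omega> \<and> \<omega> (Inr u) = e}) \<le>
        (\<Sum>u\<in>e - {v}. measure_pmf.prob P {\<omega>. missed u \<omega> \<and> \<omega> (Inr u) = e})"
      using fe by (intro measure_UNION_le) auto
    also have "\<dots> \<le> of_nat (card (e - {v})) * (1 / (r * a))"
      using prob_taken[OF eE] by (intro sum_bounded_above) auto
    finally have "measure_pmf.prob P {\<omega>. X v e \<omega>} \<le> p + real (r - 1) * (1 / (r * a))"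
      by (simp add: prob_sampled[OF eE] fe)
    also have "\<dots> = q" using r a0 by (simp add: p_def q_def field_simps)
    finally show ?thesis .
  qed
  \<comment> \<open>The extra factor \<open>x\<close> pays for replacing \<open>t - 1\<close> by
    \<open>t\<close> in the exponent.\<close>
  define Q where "Q = exp (\<kappa> * (ln r + (1 - 1 / r)) * (x - 1)) * x / x powr t"
  have prob_bad: "measure_pmf.prob P {\<omega>. bad v \<omega>} \<le> Q" if v: "v \<in> V" for v
  proof -
    have "measure_pmf.prob P {\<omega>. bad v \<omega>} \<le> exp (real (card (star E v)) * q * (x - 1)) / x powr (t - 1)"
      unfolding bad_def P_def
      by (rule chernoff_blocks_Pi_pmf[OF I finD _ depX disjS _ x])
         (use probX finE in \<open>auto simp: P_def\<close>)
    also have "\<dots> \<le> exp (\<kappa> * a * q * (x - 1)) / x powr (t - 1)"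
    proof -
      have "q \<ge> 0" using lnr r a0 by (auto simp: q_def)
      then have "real (card (star E v)) * q * (x - 1) \<le> \<kappa> * a * q * (x - 1)"
        using deg[OF v] x by (intro mult_right_mono) auto
      then show ?thesis by (simp add: divide_right_mono)
    qed
    also have "\<dots> = Q"
      using a0 x by (simp add: Q_def q_def powr_diff)
    finally show ?thesis .
  qed
  define T where "T v = (\<Union>e\<in>star E v. S v e)" for v
  have "\<exists>\<omega>\<in>set_pmf (Pi_pmf I {} D). \<forall>v\<in>V. \<not> bad v \<omega>"
  proof (rule local_lemma_Pi_pmf[OF I finD finV])
    show "depends_on (bad v) (T v)" for v
      unfolding depends_on_def
    proof (intro allI impI)
      fix \<omega> \<omega>' :: "'a set + 'a \<Rightarrow> 'a set" assume "\<forall>i\<in>T v. \<omega> i = \<omega>' i"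
      then have "X v e \<omega> = X v e \<omega>'" if "e \<in> star E v" for e
        using that by (intro depends_onD[OF depX[OF that]]) (auto simp: T_def)
      then have "{e\<in>star E v. X v e \<omega>} = {e\<in>star E v. X v e \<omega>'}" by blast
      then show "bad v \<omega> = bad v \<omega>'" by (simp add: bad_def)
    qed
    show "measure_pmf.prob (Pi_pmf I {} D) {\<omega>. bad v \<omega>} \<le> Q" if "v \<in> V" for v
      using prob_bad[OF that] by (simp add: P_def)
    show "real (card {w\<in>V. w = v \<or> T w \<inter> T v \<noteq> {}}) \<le> (\<kappa> * a * r)^3" if v: "v \<in> V" for v
    proof -
      \<comment> \<open>A coordinate common to \<open>T v\<close> and \<open>T w\<close> is an edge
        meeting both an edge at \<open>v\<close> and an edge at \<open>w\<close>, or a vertex on two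
        such edges. Either way \<open>w\<close> is reached from \<open>v\<close> in three steps
        along edges, each with at most \<open>\<kappa> * a * r\<close> targets.\<close>
      define N where "N u = \<Union>(star E u)" for u
      have NV: "N u \<subseteq> V" for u using edge by (auto simp: N_def star_def)
      have finN: "finite (N u)" for u using NV finV finite_subset by blast
      have cardN: "real (card (N u)) \<le> \<kappa> * a * r" if "u \<in> V" for u
        using card_Union_star_le[OF finE _ conjunct2[OF deg[OF that]], of r] edge_finite by (simp add: N_def)
      have b: "\<kappa> * a * r \<ge> 0" using cardN[OF v] order_trans[OF of_nat_0_le_iff] by blast
      have self: "u \<in> N u" if "u \<in> V" for u
        using star_ne[OF that] by (auto simp: N_def star_def)
      have sub: "w \<in> (\<Union>u\<in>N v. \<Union>u'\<in>N u. N u')" if w: "w \<in> V" "w = v \<or> T w \<inter> T v \<noteq> {}" for w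
      proof (cases "w = v")
        case True
        then show ?thesis using self[OF v] by auto
      next
        case False
        then obtain i e f where i: "e \<in> star E v" "f \<in> star E w" "i \<in> S v e" "i \<in> S w f"
          using w by (auto simp: T_def)
        show ?thesis
        proof (cases i)
          case (Inl g)
          with i obtain u u' where "u \<in> e" "g \<in> star E u" "u' \<in> f" "g \<in> star E u'"
            by (auto simp: S_def)
          then have "u \<in> N v" "u' \<in> N u" "w \<in> N u'"
            using i unfolding N_def star_def by blast+
          then show ?thesis by blast
        next
          case (Inr u)
          then have u: "u \<in> e" "u \<in> f" using i by (auto simp: S_def)
          then have "u \<in> N v" "u \<in> N u" "w \<in> N u"
            using i unfolding N_def star_def by blast+
          then show ?thesis by blast
        qed
      qed
      have "finite (\<Union>u\<in>N v. \<Union>u'\<in>N u. N u')" using finN by auto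
      moreover have "{w\<in>V. w = v \<or> T w \<inter> T v \<noteq> {}} \<subseteq> (\<Union>u\<in>N v. \<Union>u'\<in>N u. N u')"
        using sub by blast
      ultimately have "real (card {w\<in>V. w = v \<or> T w \<inter> T v \<noteq> {}}) \<le> real (card (\<Union>u\<in>N v. \<Union>u'\<in>N u. N u'))"
        by (simp add: card_mono)
      also have "\<dots> \<le> (\<kappa> * a * r) * ((\<kappa> * a * r) * (\<kappa> * a * r))"
        using NV v by (intro card_UN_le_real finN cardN b mult_nonneg_nonneg[OF b b]) auto
      finally show ?thesis by (simp add: power3_eq_cube mult.assoc)
    qed
    show "4 * Q * (\<kappa> * a * r)^3 \<le> 1"
      using ineq x by (simp add: Q_def field_simps)
  qed
  then obtain \<omega> where \<omega>: "\<omega> \<in> set_pmf (Pi_pmf I {} D)" "\<And>v. v \<in> V \<Longrightarrow> \<not> bad v \<omega>" by blast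
  have taken: "\<omega> (Inr u) \<in> star E u" if u: "u \<in> V" for u
  proof -
    have "Inr u \<in> I" using u by (simp add: I_def)
    then have "\<omega> (Inr u) \<in> set_pmf (D (Inr u))"
      using \<omega>(1) by (simp add: set_Pi_pmf[OF I] PiE_dflt_def)
    then show ?thesis using star_ne[OF u] finE by (simp add: D_def)
  qed
  define M where "M = {e\<in>E. \<omega> (Inl e) = e} \<union> {\<omega> (Inr u) |u. u \<in> V \<and> missed u \<omega>}"
  have ME: "M \<subseteq> E" using taken by (auto simp: M_def star_def)
  show ?thesis
  proof (intro exI[of _ M] conjI ballI ME)
    fix v assume v: "v \<in> V"
    show "star M v \<noteq> {}"
    proof (cases "missed v \<omega>")
      case True
      then have "\<omega> (Inr v) \<in> star M v" using taken[OF v] v by (auto simp: M_def star_def)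
      then show ?thesis by blast
    next
      case False
      then show ?thesis by (auto simp: missed_def M_def star_def)
    qed
    have "star M v \<subseteq> insert (\<omega> (Inr v)) {e\<in>star E v. X v e \<omega>}"
      using ME taken by (fastforce simp: M_def star_def X_def)
    then have "card (star M v) \<le> card (insert (\<omega> (Inr v)) {e\<in>star E v. X v e \<omega>})"
      using finE by (intro card_mono) auto
    also have "\<dots> \<le> Suc (card {e\<in>star E v. X v e \<omega>})" by (rule card_insert_le_m1) auto
    finally show "real (card (star M v)) \<le> t" using \<omega>(2)[OF v] by (simp add: bad_def)
  qed
qed

end

lemma (in linear_triangle_free) shallow_hitting_if_near_regular:
  fixes \<delta> \<mu> s0 t x :: real
  assumes \<mu>: "\<mu> \<ge> 1" and \<delta>: "\<delta> > 0" and s0: "s0 \<ge> 2" and x: "x \<ge> 1"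
    and deg: "\<And>v. v \<in> V \<Longrightarrow> \<delta> \<le> real (card (star E v)) \<and> real (card (star E v)) \<le> \<mu> * \<delta>"
    and large: "\<And>s. s \<ge> s0 \<Longrightarrow> 16 * \<mu> * r * s^4 \<le> exp (s\<^sup>2 / 1024)"
    and t: "(1 + 4 / s0) * \<mu> * ln r \<le> t"
    and ineq: "4 * exp ((1 + 4 / s0) * \<mu> * (ln r + (1 - 1 / r)) * (x - 1)) * x *
                 ((1 + 4 / s0) * \<mu> * (16 * s0^4) * r)^3 \<le> x powr t"
  shows "\<exists>M\<subseteq>E. \<forall>v\<in>V. star M v \<noteq> {} \<and> real (card (star M v)) \<le> t"
proof -
  define \<kappa> where "\<kappa> = (1 + 4 / s0) * \<mu>"
  have \<kappa>: "\<kappa> \<ge> 0" using \<mu> s0 by (simp add: \<kappa>_def)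
  have Eprop: "\<forall>e\<in>E. finite e \<and> card e = r" using edge_finite by blast
  obtain F a where F: "F \<subseteq> E" and a: "a > 0" "a \<le> 16 * s0^4"
    and degF: "\<And>v. v \<in> V \<Longrightarrow> a \<le> real (card (star F v)) \<and> real (card (star F v)) \<le> \<kappa> * a"
    using sparsify[OF finV finE Eprop s0 \<mu> \<delta> deg large] unfolding \<kappa>_def by blast
  have "\<exists>M\<subseteq>F. \<forall>v\<in>V. star M v \<noteq> {} \<and> real (card (star M v)) \<le> t"
  proof (cases "ln r < a")
    case True
    interpret F: linear_triangle_free V F r by (rule sub_hypergraph[OF F])
    show ?thesis
    proof (rule F.shallow_hitting_if_chernoff[OF degF True x])
      have "(\<kappa> * a * r)^3 \<le> (\<kappa> * (16 * s0^4) * r)^3"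
        using \<kappa> a by (intro power_mono mult_right_mono mult_left_mono) auto
      then have "4 * exp (\<kappa> * (ln r + (1 - 1 / r)) * (x - 1)) * x * (\<kappa> * a * r)^3 \<le>
            4 * exp (\<kappa> * (ln r + (1 - 1 / r)) * (x - 1)) * x * (\<kappa> * (16 * s0^4) * r)^3"
        using x by (intro mult_left_mono) auto
      also have "\<dots> \<le> x powr t" using ineq by (simp add: \<kappa>_def)
      finally show "4 * exp (\<kappa> * (ln r + (1 - 1 / r)) * (x - 1)) * x * (\<kappa> * a * r)^3 \<le> x powr t" .
    qed
  next
    \<comment> \<open>Here \<open>ln r / a\<close> may exceed 1 and is no probability, but the
      degrees in \<open>F\<close>, at most \<open>\<kappa> * a \<le> \<kappa> * ln r\<close>, are
      already small enough to take all of \<open>F\<close>.\<close>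
    case False
    show ?thesis
    proof (intro exI[of _ F] conjI ballI)
      fix v assume v: "v \<in> V"
      show "star F v \<noteq> {}" using degF[OF v] a by auto
      have "\<kappa> * a \<le> \<kappa> * ln r" using False \<kappa> by (intro mult_left_mono) auto
      then show "real (card (star F v)) \<le> t" using degF[OF v] t by (simp add: \<kappa>_def)
    qed simp
  qed
  then show ?thesis using F by blast
qed

subsection \<open>Asymptotic estimates\<close>

text \<open>The fourth root of the degree at which sparsification stops. Being at least
  \<open>4096 = 4 * 1024\<close> gives \<open>s\<^sup>2 / 1024 \<ge> 4 * s\<close>, where
  \<open>exp s\<close> absorbs \<open>\<mu> * r\<close> and \<open>exp (3 * s)\<close> absorbs
  \<open>16 * s^4\<close>. The summand \<open>ln r\<close> also keeps the effect of the factor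
  \<open>1 + 4 / s0\<close> on \<open>ln r\<close> bounded.\<close>

definition scale :: "real \<Rightarrow> real \<Rightarrow> real" where
  "scale \<mu> r = 4096 + ln \<mu> + ln r"

lemma scale_ge: "\<mu> \<ge> 1 \<Longrightarrow> r \<ge> 1 \<Longrightarrow> scale \<mu> r \<ge> 4096"
  by (simp add: scale_def)

lemma scale_large:
  fixes \<mu> r s :: real
  assumes \<mu>: "\<mu> \<ge> 1" and r: "r \<ge> 1" and s: "s \<ge> scale \<mu> r"
  shows "16 * \<mu> * r * s^4 \<le> exp (s\<^sup>2 / 1024)"
proof -
  have s4: "s \<ge> 4096" using scale_ge[OF \<mu> r] s by linarith
  have "\<mu> * r = exp (ln \<mu> + ln r)" using \<mu> r by (simp add: exp_add)
  also have "\<dots> \<le> exp s" using s by (simp add: scale_def)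
  finally have 1: "\<mu> * r \<le> exp s" .
  have "16 * s^4 \<le> (s/2)^6"
  proof -
    have "1024 \<le> s^2" using power_mono[of 32 s 2] s4 by simp
    then have "1024 * s^4 \<le> s^2 * s^4" using s4 by (intro mult_right_mono) auto
    then show ?thesis by (simp add: power_divide flip: power_add)
  qed
  also have "\<dots> \<le> exp (s/2) ^ 6"
  proof (rule power_mono)
    show "s/2 \<le> exp (s/2)" using exp_ge_add_one_self[of "s/2"] by linarith
  qed (use s4 in simp)
  also have "\<dots> = exp (3 * s)" by (simp flip: exp_of_nat_mult)
  finally have 2: "16 * s^4 \<le> exp (3 * s)" .
  have "16 * \<mu> * r * s^4 = (\<mu> * r) * (16 * s^4)" by simp
  also have "\<dots> \<le> exp s * exp (3 * s)" using 1 2 \<mu> r by (intro mult_mono) auto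
  also have "\<dots> = exp (4 * s)" by (simp flip: exp_add)
  also have "\<dots> \<le> exp (s\<^sup>2 / 1024)"
    using mult_right_mono[OF s4, of s] s4 by (simp add: power2_eq_square)
  finally show ?thesis .
qed

lemma powr_bound_from_ln:
  fixes L x b t :: real
  assumes "x \<ge> 1" "b > 0" "ln 4 + L + ln x + 3 * ln b \<le> t * ln x"
  shows "4 * exp L * x * b^3 \<le> x powr t"
proof -
  have "4 * exp L * x * b^3 = exp (ln 4 + L + ln x + 3 * ln b)"
    using assms by (simp add: exp_add ln_realpow flip: exp_of_nat_mult) (simp add: exp_of_nat_mult[of 3, simplified])
  also have "\<dots> \<le> exp (t * ln x)" using assms by simp
  finally show ?thesis using assms by (simp add: powr_def)
qed

text \<open>Since \<open>c = exp (1 + w)\<close>, the excess \<open>c * \<mu> * (ln c - 1)\<close>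
  is \<open>exp 1 * \<mu> * (w * exp w)\<close>, which the Lambert equation makes equal to 2. The
  upper bound is \<open>w \<le> w * exp w\<close>.\<close>

lemma c_const_props:
  fixes \<mu> :: real
  assumes \<mu>: "\<mu> > 0"
  defines "c \<equiv> c_const \<mu>"
  shows "exp 1 \<le> c" "c \<le> exp (1 + 2 / (exp 1 * \<mu>))" "c * \<mu> * ln c = c * \<mu> + 2"
proof -
  define w where "w = lambert_W (2 / (exp 1 * \<mu>))"
  have "- exp (-1) \<le> (0::real)" by simp
  also have "0 \<le> 2 / (exp 1 * \<mu>)" using \<mu> by simp
  finally have w: "w * exp w = 2 / (exp 1 * \<mu>)" unfolding w_def by (rule lambert_W)
  then have "w * exp w > 0" using \<mu> by simp
  then have w0: "w > 0" by (simp add: zero_less_mult_iff)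
  then have "w * 1 \<le> w * exp w" by (intro mult_left_mono) auto
  then have wle: "w \<le> 2 / (exp 1 * \<mu>)" using w by simp
  have c: "c = exp (1 + w)" by (simp add: c_def c_const_def w_def)
  show "exp 1 \<le> c" "c \<le> exp (1 + 2 / (exp 1 * \<mu>))" using w0 wle by (simp_all add: c)
  have "ln c = 1 + w" by (simp add: c)
  then have "c * \<mu> * ln c = c * \<mu> + exp 1 * \<mu> * (w * exp w)" by (simp add: c exp_add algebra_simps)
  also have "\<dots> = c * \<mu> + 2" using \<mu> unfolding w by simp
  finally show "c * \<mu> * ln c = c * \<mu> + 2" .
qed

lemma exp_1_ge: "exp 1 \<ge> (5/2 :: real)"
  using exp_lower_Taylor_quadratic[of 1] by simp

lemma one_minus_inverse_le_ln: "r > 0 \<Longrightarrow> 1 - 1 / r \<le> ln (r::real)"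
  using ln_le_minus_one[of "1 / r"] by (simp add: ln_div)

lemma ln_2_ge_half: "ln 2 \<ge> (1/2 :: real)"
  using one_minus_inverse_le_ln[of 2] by simp

text \<open>For large \<open>\<mu>\<close> the constant \<open>e\<close> leaves slack even without an error term, since
  \<open>ln r + (1 - 1/r) \<le> 2 ln r\<close> and \<open>2 < e\<close>.\<close>

lemma chernoff_large_degree_ratio:
  "\<exists>m\<ge>1. \<forall>\<mu> r :: real. \<mu> \<ge> m \<longrightarrow> r \<ge> 2 \<longrightarrow>
     4 * exp ((1 + 4 / scale \<mu> r) * \<mu> * (ln r + (1 - 1 / r)) * (9 / 8 - 1)) * (9 / 8) *
       ((1 + 4 / scale \<mu> r) * \<mu> * (16 * scale \<mu> r ^ 4) * r)^3 \<le> (9 / 8) powr (exp 1 * \<mu> * ln r)"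
proof -
  define A :: real where "A = ln 4 + ln (9 / 8) + 3 * (ln 32 + 4 * ln 4096)"
  have "eventually (\<lambda>\<mu>. A + 4 * ln \<mu> \<le> \<mu> / 160) at_top" by real_asymp
  then obtain m0 where m0: "\<And>\<mu>. \<mu> \<ge> m0 \<Longrightarrow> A + 4 * ln \<mu> \<le> \<mu> / 160"
    by (auto simp: eventually_at_top_linorder)
  show ?thesis
  \<comment> \<open>The gap \<open>5/18 - 101/400\<close> between the main terms exceeds
    \<open>1/40\<close>. One half of it absorbs the lower order terms in \<open>ln r\<close>, by
    \<open>\<mu> \<ge> 320\<close>; the other half absorbs the constants and the terms in
    \<open>ln \<mu>\<close>, by \<open>\<mu> \<ge> m0\<close> and
    \<open>ln r \<ge> 1/2\<close>.\<close>
  proof (intro exI[of _ "max 320 m0"] conjI allI impI)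
    fix \<mu> r :: real assume "\<mu> \<ge> max 320 m0" and r: "r \<ge> 2"
    then have \<mu>: "\<mu> \<ge> 320" and A: "A + 4 * ln \<mu> \<le> \<mu> / 160" using m0 by auto
    define s0 where "s0 = scale \<mu> r"
    have s0: "s0 \<ge> 4096" using scale_ge[of \<mu> r] \<mu> r by (simp add: s0_def)
    have \<kappa>: "1 + 4 / s0 \<le> 101/100" using s0 by (simp add: field_simps)
    have lnr: "ln r \<ge> 1/2" using ln_2_ge_half r ln_mono[of 2 r] by linarith
    have ln\<mu>: "ln \<mu> \<ge> 0" using \<mu> by simp
    have "\<mu> * (1/2) \<le> \<mu> * ln r" using lnr \<mu> by (intro mult_left_mono) auto
    then have \<mu>1: "\<mu> / 160 \<le> \<mu> * ln r / 80" by simp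
    have \<mu>2: "4 * ln r \<le> \<mu> * ln r / 80" using mult_right_mono[OF \<mu>, of "ln r"] lnr by simp
    have "ln s0 = ln 4096 + ln (1 + (ln \<mu> + ln r) / 4096)"
      using ln\<mu> lnr by (subst ln_mult_pos[symmetric]) (auto simp: s0_def scale_def add_pos_nonneg)
    also have "\<dots> \<le> ln 4096 + (ln \<mu> + ln r) / 4096"
      using ln\<mu> lnr by (intro add_left_mono ln_add_one_self_le_self) auto
    finally have lns0: "ln s0 \<le> ln 4096 + (ln \<mu> + ln r) / 4096" .
    have "ln ((1 + 4 / s0) * \<mu> * (16 * s0^4) * r) \<le> ln (32 * \<mu> * s0^4 * r)"
    proof (rule ln_mono)
      have "(1 + 4 / s0) * (\<mu> * (16 * s0^4) * r) \<le> 2 * (\<mu> * (16 * s0^4) * r)"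
        using \<kappa> \<mu> r s0 by (intro mult_right_mono) auto
      then show "(1 + 4 / s0) * \<mu> * (16 * s0^4) * r \<le> 32 * \<mu> * s0^4 * r" by simp
    qed (use \<mu> r s0 in \<open>auto intro!: mult_pos_pos add_pos_pos\<close>)
    also have "\<dots> = ln 32 + ln \<mu> + 4 * ln s0 + ln r"
      using \<mu> r s0 by (simp add: ln_mult_pos ln_realpow)
    finally have b: "ln ((1 + 4 / s0) * \<mu> * (16 * s0^4) * r) \<le> ln 32 + ln \<mu> + 4 * ln s0 + ln r" .
    have "(1 + 4 / s0) * \<mu> * (ln r + (1 - 1 / r)) \<le> 101/100 * \<mu> * (2 * ln r)"
      using \<kappa> \<mu> r lnr s0 one_minus_inverse_le_ln[of r]
      by (intro mult_mono) (auto simp: field_simps)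
    from mult_right_mono[OF this, of "9 / 8 - 1"]
    have L: "(1 + 4 / s0) * \<mu> * (ln r + (1 - 1 / r)) * (9 / 8 - 1) \<le> 101/400 * (\<mu> * ln r)" by simp
    \<comment> \<open>For base x the comparison is between \<open>2 * (x - 1)\<close> and
      \<open>exp 1 * ln x\<close>. At 9/8 even the crude bounds 5/2 for e and 1/9 for the logarithm
      give 5/18 against 1/4.\<close>
    have "5/2 * (\<mu> * ln r) * (1/9) \<le> exp 1 * (\<mu> * ln r) * ln (9 / 8)"
      using exp_1_ge \<mu> lnr one_minus_inverse_le_ln[of "9/8"]
      by (intro mult_mono) auto
    then have R: "5/18 * (\<mu> * ln r) \<le> exp 1 * \<mu> * ln r * ln (9 / 8)" by (simp add: mult_ac)
    have "4 * exp ((1 + 4 / s0) * \<mu> * (ln r + (1 - 1 / r)) * (9 / 8 - 1)) * (9 / 8) *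
       ((1 + 4 / s0) * \<mu> * (16 * s0 ^ 4) * r)^3 \<le> (9 / 8) powr (exp 1 * \<mu> * ln r)"
    proof (rule powr_bound_from_ln)
      show "(1 + 4 / s0) * \<mu> * (16 * s0 ^ 4) * r > 0"
        using \<mu> r s0 by (auto intro!: mult_pos_pos add_pos_pos)
      define U Z W T where "U = \<mu> * ln r"
        and "Z = (1 + 4 / s0) * \<mu> * (ln r + (1 - 1 / r)) * (9 / 8 - 1)"
        and "W = ln ((1 + 4 / s0) * \<mu> * (16 * s0 ^ 4) * r)"
        and "T = exp 1 * \<mu> * ln r * ln (9 / 8)"
      have "U \<ge> 0" using \<mu> lnr by (simp add: U_def)
      moreover have "W \<le> ln 32 + ln \<mu> + 4 * ln s0 + ln r" "Z \<le> 101/400 * U" "5/18 * U \<le> T"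
        "\<mu> / 160 \<le> U / 80" "4 * ln r \<le> U / 80"
        using b L R \<mu>1 \<mu>2 unfolding U_def Z_def W_def T_def by blast+
      ultimately have "ln 4 + Z + ln (9 / 8) + 3 * W \<le> T"
        using lns0 A ln\<mu> lnr unfolding A_def by argo
      then show "ln 4 + (1 + 4 / s0) * \<mu> * (ln r + (1 - 1 / r)) * (9 / 8 - 1) + ln (9 / 8) +
          3 * ln ((1 + 4 / s0) * \<mu> * (16 * s0 ^ 4) * r) \<le> exp 1 * \<mu> * ln r * ln (9 / 8)"
        unfolding Z_def W_def T_def .
    qed simp
    then show "4 * exp ((1 + 4 / scale \<mu> r) * \<mu> * (ln r + (1 - 1 / r)) * (9 / 8 - 1)) * (9 / 8) *
       ((1 + 4 / scale \<mu> r) * \<mu> * (16 * scale \<mu> r ^ 4) * r)^3 \<le> (9 / 8) powr (exp 1 * \<mu> * ln r)"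
      by (simp add: s0_def)
  qed simp
qed

text \<open>The numerator collects the lower order terms of the exponent:
  \<open>6 * m * exp 2\<close> from the perturbed mean, \<open>ln 4\<close> from the local lemma, 2
  as a bound for \<open>ln c\<close>, and the rest from the cubed neighbourhood size. Using
  \<open>m\<close> in place of \<mu> makes it uniform over \<open>\<mu> \<le> m\<close>.\<close>

definition small_ratio_error :: "real \<Rightarrow> real \<Rightarrow> real" where
  "small_ratio_error m r = (6 * m * exp 2 + ln 4 + 2 + 3 * ln (32 * m) + 12 * ln (scale m r)) / ln r"

lemma small_ratio_error_nonneg: "m \<ge> 1 \<Longrightarrow> r \<ge> 2 \<Longrightarrow> small_ratio_error m r \<ge> 0"
  using scale_ge[of m r] by (auto simp: small_ratio_error_def intro!: divide_nonneg_nonneg add_nonneg_nonneg)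

lemma small_ratio_error_tendsto: "(small_ratio_error m \<longlongrightarrow> 0) at_top"
  unfolding small_ratio_error_def[abs_def] scale_def by real_asymp

text \<open>The limit controls only large \<open>r\<close>, whereas the final O-bound is uniform
  over all \<open>r \<ge> 2\<close>; there \<open>ln r \<ge> 1/2\<close> and the crude
  \<open>ln (scale m r) \<le> scale m r\<close> suffice.\<close>

lemma small_ratio_error_bounded:
  assumes m: "m \<ge> 1"
  shows "\<exists>C. \<forall>r\<ge>2. small_ratio_error m r \<le> C"
proof (intro exI allI impI)
  fix r :: real assume r: "r \<ge> 2"
  define B where "B = 6 * m * exp 2 + ln 4 + 2 + 3 * ln (32 * m) + 12 * (4096 + ln m)"
  have lnr: "ln r \<ge> 1/2" using ln_2_ge_half r ln_mono[of 2 r] by linarith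
  have "B \<ge> 0" using m by (auto simp: B_def intro!: add_nonneg_nonneg)
  have "ln (scale m r) \<le> scale m r" using scale_ge[of m r] m r ln_le_minus_one[of "scale m r"] by linarith
  then have "small_ratio_error m r \<le> (B + 12 * ln r) / ln r"
    unfolding small_ratio_error_def B_def scale_def using lnr by (intro divide_right_mono) auto
  also have "\<dots> = B / ln r + 12" using lnr by (simp add: field_simps)
  also have "\<dots> \<le> B / (1/2) + 12"
    using \<open>B \<ge> 0\<close> lnr by (intro add_right_mono divide_left_mono) auto
  finally show "small_ratio_error m r \<le> B / (1/2) + 12" unfolding B_def .
qed

text \<open>With \<open>c\<close> defined by \<open>c \<mu> ln c = c \<mu> + 2\<close>, the Chernoff bound beats the number \<open>r\<^sup>3\<close> of
  dependent events up to lower order terms, because \<open>\<mu> (c - 1) + 3 \<le> c \<mu> + 2\<close>.\<close>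

lemma chernoff_small_degree_ratio:
  fixes \<mu> m r :: real
  assumes \<mu>: "\<mu> \<ge> 1" "\<mu> \<le> m" and r: "r \<ge> 2"
  defines "c \<equiv> c_const \<mu>"
  shows "4 * exp ((1 + 4 / scale \<mu> r) * \<mu> * (ln r + (1 - 1 / r)) * (c - 1)) * c *
       ((1 + 4 / scale \<mu> r) * \<mu> * (16 * scale \<mu> r ^ 4) * r)^3 \<le> c powr (c * \<mu> * ln r * (1 + small_ratio_error m r))"
proof (rule powr_bound_from_ln)
  define s0 where "s0 = scale \<mu> r"
  have s0: "s0 \<ge> 4096" using scale_ge[of \<mu> r] \<mu> r by (simp add: s0_def)
  have lnr: "ln r \<ge> 1/2" using ln_2_ge_half r ln_mono[of 2 r] by linarith
  have c: "exp 1 \<le> c" "c * \<mu> * ln c = c * \<mu> + 2" using c_const_props[of \<mu>] \<mu> by (auto simp: c_def)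
  have "2 / (exp 1 * \<mu>) \<le> 1"
    using mult_mono[of "5/2" "exp 1" 1 \<mu>] exp_1_ge \<mu> by (simp add: field_simps)
  then have c2: "c \<le> exp 2" using c_const_props(2)[of \<mu>] \<mu> by (simp add: c_def order_trans)
  have c1: "c \<ge> 5/2" using c exp_1_ge by linarith
  then show "1 \<le> c" by simp
  have lnc: "ln c \<le> 2" using c2 c1 by (simp add: ln_le_cancel_iff[of c "exp 2", symmetric] del: ln_le_cancel_iff)
  show "(1 + 4 / scale \<mu> r) * \<mu> * (16 * scale \<mu> r ^ 4) * r > 0"
    using \<mu> r s0 unfolding s0_def by (auto intro!: mult_pos_pos add_pos_pos)
  have s0m: "s0 \<le> scale m r" using \<mu> by (simp add: s0_def scale_def)
  have "ln ((1 + 4 / s0) * \<mu> * (16 * s0^4) * r) \<le> ln (32 * m * scale m r ^4 * r)"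
  proof (rule ln_mono)
    have "(1 + 4 / s0) * (\<mu> * (16 * s0^4) * r) \<le> 2 * (m * (16 * scale m r^4) * r)"
      using \<mu> r s0 s0m by (intro mult_mono power_mono) (auto simp: field_simps)
    then show "(1 + 4 / s0) * \<mu> * (16 * s0^4) * r \<le> 32 * m * scale m r^4 * r" by simp
  qed (use \<mu> r s0 in \<open>auto intro!: mult_pos_pos add_pos_pos\<close>)
  also have "\<dots> = ln (32 * m) + 4 * ln (scale m r) + ln r"
    using \<mu> r s0 s0m by (simp add: ln_mult_pos ln_realpow)
  finally have b: "ln ((1 + 4 / s0) * \<mu> * (16 * s0^4) * r) \<le> ln (32 * m) + 4 * ln (scale m r) + ln r" .
  define Y where "Y = \<mu> * (c - 1)"
  have Y: "0 \<le> Y" "Y \<le> m * exp 2"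
    unfolding Y_def using \<mu> c1 c2 by (auto intro!: mult_mono)
  \<comment> \<open>With the bound 2 for the term in \<open>1 - 1 / r\<close>, this yields the 6 in
    \<open>small_ratio_error\<close>.\<close>
  have "(4 / s0) * ln r \<le> 4"
  proof -
    have "ln r \<le> s0" using \<mu> by (simp add: s0_def scale_def)
    then show ?thesis using s0 by (simp add: field_simps)
  qed
  moreover have "(1 + 4 / s0) * (1 - 1 / r) \<le> 2 * 1"
    using s0 r by (intro mult_mono) (auto simp: field_simps)
  ultimately have "(1 + 4 / s0) * (ln r + (1 - 1 / r)) \<le> ln r + 6"
    by (simp add: distrib_left distrib_right)
  then have "((1 + 4 / s0) * (ln r + (1 - 1 / r))) * Y \<le> (ln r + 6) * Y"
    using Y by (intro mult_right_mono) auto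
  also have "\<dots> \<le> Y * ln r + 6 * (m * exp 2)" using Y(2) by (simp add: algebra_simps)
  finally have L: "(1 + 4 / s0) * \<mu> * (ln r + (1 - 1 / r)) * (c - 1) \<le> Y * ln r + 6 * (m * exp 2)"
    by (simp add: Y_def mult_ac)
  have e: "small_ratio_error m r * ln r = 6 * m * exp 2 + ln 4 + 2 + 3 * ln (32 * m) + 12 * ln (scale m r)"
    using lnr by (simp add: small_ratio_error_def)
  have "small_ratio_error m r * ln r \<ge> 0" using small_ratio_error_nonneg[of m r] \<mu> r lnr by simp
  moreover have "c * \<mu> \<ge> 0" using c1 \<mu> by simp
  \<comment> \<open>\<open>c * \<mu> * ln c = c * \<mu> + 2 \<ge> 1\<close>, so the error term in
    the threshold raises the exponent by at least \<open>small_ratio_error m r * ln r\<close>,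
    exactly the lower order terms collected there.\<close>
  ultimately have "1 * (small_ratio_error m r * ln r) \<le> (c * \<mu> + 2) * (small_ratio_error m r * ln r)"
    by (intro mult_right_mono) auto
  moreover have "c * \<mu> * ln r * (1 + small_ratio_error m r) * ln c = (c * \<mu> * ln c) * ln r + (c * \<mu> * ln c) * (small_ratio_error m r * ln r)"
    by (simp add: algebra_simps)
  ultimately have R: "c * \<mu> * ln r * (1 + small_ratio_error m r) * ln c \<ge> (c * \<mu> + 2) * ln r + small_ratio_error m r * ln r"
    unfolding c(2) by linarith
  have "(Y + 3) * ln r \<le> (c * \<mu> + 2) * ln r"
    using \<mu> lnr unfolding Y_def by (intro mult_right_mono) (auto simp: algebra_simps)
  then have "ln 4 + (1 + 4 / s0) * \<mu> * (ln r + (1 - 1 / r)) * (c - 1) + ln c +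
        3 * ln ((1 + 4 / s0) * \<mu> * (16 * s0 ^ 4) * r) \<le> c * \<mu> * ln r * (1 + small_ratio_error m r) * ln c"
    using b L R e lnc by (simp add: distrib_right)
  then show "ln 4 + (1 + 4 / scale \<mu> r) * \<mu> * (ln r + (1 - 1 / r)) * (c - 1) + ln c +
        3 * ln ((1 + 4 / scale \<mu> r) * \<mu> * (16 * scale \<mu> r ^ 4) * r) \<le> c * \<mu> * ln r * (1 + small_ratio_error m r) * ln c"
    by (simp add: s0_def)
qed

subsection \<open>Hypergraphs of girth at least 4\<close>

lemma length_ge_girth: "is_cycle E vs es \<Longrightarrow> girth E \<le> enat (length vs)"
  unfolding girth_def by (rule Inf_lower) blast

text \<open>Two edges with two common vertices form a cycle of length 2, and a triangle is one of
  length 3. Two copies of one edge count as two edges of a cycle, which rules out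
  multiplicities.\<close>

lemma girth_ge_4_imp_linear_triangle_free:
  assumes H: "hypergraph V E" and r: "r \<ge> 2" and unif: "uniform r E" and girth: "girth E \<ge> 4"
  shows "linear_triangle_free V (set_mset E) r" "E = mset_set (set_mset E)"
proof -
  have no_cycle: "\<not> is_cycle E vs es" if "length vs \<le> 3" for vs es
  proof
    assume "is_cycle E vs es"
    from order_trans[OF girth length_ge_girth[OF this]] show False
      using that by (simp add: numeral_eq_enat)
  qed
  have edge: "e \<subseteq> V" "card e = r" if "e \<in># E" for e
    using that H unif by (auto simp: hypergraph_def uniform_def)
  have pair: "\<not> {#e, f#} \<subseteq># E" if "{u, v} \<subseteq> e" "{u, v} \<subseteq> f" "u \<noteq> v" for e f u v
  proof
    assume "{#e, f#} \<subseteq># E"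
    then have "is_cycle E [u, v] [e, f]"
      using that by (auto simp: is_cycle_def less_Suc_eq)
    then show False using no_cycle by force
  qed
  show "linear_triangle_free V (set_mset E) r"
  proof
    show "finite V" using H by (simp add: hypergraph_def)
    fix e f g u v w
    {
      assume *: "e \<in># E" "f \<in># E" "{u, v} \<subseteq> e" "{u, v} \<subseteq> f" "u \<noteq> v"
      show "e = f"
      proof (rule ccontr)
        assume "e \<noteq> f"
        then have "{#e, f#} \<subseteq># E" using * by (auto simp: insert_subset_eq_iff in_diff_count)
        then show False using pair * by blast
      qed
    next
      assume *: "{e, f, g} \<subseteq> set_mset E" "{u, v} \<subseteq> e" "{v, w} \<subseteq> f" "{w, u} \<subseteq> g" "distinct [u, v, w]"
      show "\<not> distinct [e, f, g]"
      proof
        assume "distinct [e, f, g]"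
        then have "{#e, f, g#} \<subseteq># E" using * by (auto simp: insert_subset_eq_iff in_diff_count)
        then have "is_cycle E [u, v, w] [e, f, g]"
          using * by (auto simp: is_cycle_def less_Suc_eq)
        then show False using no_cycle by force
      qed
    }
  qed (use r edge in auto)
  show "E = mset_set (set_mset E)"
  proof (rule multiset_eqI)
    fix e
    have "\<not> count E e \<ge> 2"
    proof
      assume *: "count E e \<ge> 2"
      then have "e \<in># E" by (auto simp flip: count_greater_zero_iff)
      then have "2 \<le> card e" using edge r by simp
      then obtain T where "T \<subseteq> e" "card T = 2" by (rule obtain_subset_with_card_n)
      then obtain u v where "{u, v} \<subseteq> e" "u \<noteq> v" by (auto simp: card_2_iff)
      moreover have "{#e, e#} \<subseteq># E" using * by (auto simp: subseteq_mset_def)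
      ultimately show False using pair by blast
    qed
    then show "count E e = count (mset_set (set_mset E)) e"
      by (cases "e \<in># E") (auto simp: not_in_iff simp flip: count_greater_zero_iff)
  qed
qed

lemma degree_in_mset_set: "finite M \<Longrightarrow> degree_in (mset_set M) v = card (star M v)"
  by (simp add: degree_in_def star_def)

lemma near_regular_degrees:
  fixes \<mu> :: real
  assumes "near_regular \<mu> V E" "finite V" "V \<noteq> {}"
  shows "min_deg V E > 0" "\<mu> \<ge> 1"
    "\<And>v. v \<in> V \<Longrightarrow> min_deg V E \<le> degree_in E v \<and> degree_in E v \<le> \<mu> * min_deg V E"
proof -
  show min: "min_deg V E > 0" using assms by (simp add: near_regular_def)
  have max: "real (max_deg V E) \<le> \<mu> * min_deg V E"
    using assms min by (simp add: near_regular_def field_simps)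
  have bd: "min_deg V E \<le> degree_in E v" "degree_in E v \<le> max_deg V E" if "v \<in> V" for v
    using assms that by (auto simp: min_deg_def max_deg_def)
  show "min_deg V E \<le> degree_in E v \<and> degree_in E v \<le> \<mu> * min_deg V E" if "v \<in> V" for v
    using bd[OF that] max by linarith
  obtain v where "v \<in> V" using assms(3) by blast
  then have "1 * real (min_deg V E) \<le> \<mu> * min_deg V E" using bd[of v] max by linarith
  then show "\<mu> \<ge> 1" using min by (subst (asm) mult_le_cancel_right) simp
qed

lemma shallow_mono: "shallow t V M \<Longrightarrow> t \<le> t' \<Longrightarrow> shallow t' V M"
  unfolding shallow_def by (auto intro: order_trans)

lemma shallow_hitting_edge_set:
  assumes H: "hypergraph V E" "r \<ge> 2" "uniform r E" "near_regular \<mu> V E" "girth E \<ge> 4"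
    and V: "V \<noteq> {}" and \<mu>: "\<mu> \<ge> 1" and x: "x \<ge> 1" and t: "t \<ge> 2 * \<mu> * ln r"
    and ineq: "4 * exp ((1 + 4 / scale \<mu> r) * \<mu> * (ln r + (1 - 1 / r)) * (x - 1)) * x *
                 ((1 + 4 / scale \<mu> r) * \<mu> * (16 * scale \<mu> r ^ 4) * r)^3 \<le> x powr t"
  shows "\<exists>M. M \<subseteq># E \<and> hitting V M \<and> shallow t V M"
proof -
  interpret linear_triangle_free V "set_mset E" r
    by (rule girth_ge_4_imp_linear_triangle_free(1)[OF H(1,2,3,5)])
  have E: "E = mset_set (set_mset E)"
    by (rule girth_ge_4_imp_linear_triangle_free(2)[OF H(1,2,3,5)])
  note deg = near_regular_degrees[OF H(4) finV V]
  have scale: "scale \<mu> r \<ge> 4096" using scale_ge[of \<mu> r] \<mu> r by simp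
  have degE: "degree_in E v = card (star (set_mset E) v)" for v
    using degree_in_mset_set[of "set_mset E" v] E by simp
  have "\<exists>M\<subseteq>set_mset E. \<forall>v\<in>V. star M v \<noteq> {} \<and> real (card (star M v)) \<le> t"
  proof (rule shallow_hitting_if_near_regular[OF \<mu>, where \<delta> = "min_deg V E" and x = x])
    show "(1 + 4 / scale \<mu> r) * \<mu> * ln r \<le> t"
    proof -
      have "(1 + 4 / scale \<mu> r) * (\<mu> * ln r) \<le> 2 * (\<mu> * ln r)"
        using scale \<mu> r by (intro mult_right_mono) auto
      then show ?thesis using t by simp
    qed
    show "16 * \<mu> * real r * s^4 \<le> exp (s\<^sup>2 / 1024)" if "s \<ge> scale \<mu> r" for s
      using scale_large[OF \<mu> _ that] r by simp
  qed (use deg scale x ineq degE in auto)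
  then obtain M where M: "M \<subseteq> set_mset E"
    and Mv: "\<And>v. v \<in> V \<Longrightarrow> star M v \<noteq> {} \<and> real (card (star M v)) \<le> t" by blast
  have finM: "finite M" using M finite_subset by auto
  have "mset_set M \<subseteq># E"
    using subset_imp_msubset_mset_set[OF M] E by simp
  moreover have "hitting V (mset_set M)"
    using Mv finM by (auto simp: hitting_def degree_in_mset_set Suc_le_eq card_gt_0_iff)
  moreover have "shallow t V (mset_set M)"
    using Mv finM by (auto simp: shallow_def degree_in_mset_set)
  ultimately show ?thesis by blast
qed

section \<open>Limits of the constant and the error, and the order of the bound\<close>

lemma c_const_tendsto: "(c_const \<longlongrightarrow> exp 1) at_top"
proof (rule tendsto_sandwich)
  show "eventually (\<lambda>\<mu>. exp 1 \<le> c_const \<mu>) at_top"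
    using eventually_gt_at_top[of 0] by eventually_elim (rule c_const_props)
  show "eventually (\<lambda>\<mu>. c_const \<mu> \<le> exp (1 + 2 / (exp 1 * \<mu>))) at_top"
    using eventually_gt_at_top[of 0] by eventually_elim (rule c_const_props)
  show "((\<lambda>\<mu>. exp (1 + 2 / (exp 1 * \<mu>))) \<longlongrightarrow> exp (1::real)) at_top" by real_asymp
qed simp

text \<open>The value 0 for \<open>r < 2\<close> keeps the function nonnegative where
  \<open>ln r\<close> is small or negative.\<close>

definition error :: "real \<Rightarrow> real \<Rightarrow> real \<Rightarrow> real" where
  "error m \<mu> r = (if \<mu> \<ge> m \<or> r < 2 then 0 else small_ratio_error m r)"

lemma error_tendsto:
  assumes m: "m \<ge> 1"
  shows "((\<lambda>(\<mu>, r). error m \<mu> r) \<longlongrightarrow> 0) prod_at_top"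
proof (rule tendstoI)
  fix d :: real assume "d > 0"
  with small_ratio_error_tendsto have "eventually (\<lambda>r. dist (small_ratio_error m r) 0 < d) at_top" by (rule tendstoD)
  then obtain N where N: "\<And>r. r \<ge> N \<Longrightarrow> dist (small_ratio_error m r) 0 < d" by (auto simp: eventually_at_top_linorder)
  \<comment> \<open>For \<open>\<mu> < m\<close>, the threshold \<open>m * N\<close> on the product
    forces \<open>r \<ge> N\<close>; for the other \<mu> the error is 0.\<close>
  have "dist (error m \<mu> r) 0 < d" if *: "\<mu> \<ge> 0" "r \<ge> 0" "\<mu> * r \<ge> m * N" for \<mu> r
  proof (cases "\<mu> \<ge> m")
    case True
    then show ?thesis using \<open>d > 0\<close> by (simp add: error_def)
  next
    case False
    then have "\<mu> * r \<le> m * r" using * by (intro mult_right_mono) auto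
    then have "r \<ge> N" using * m mult_le_cancel_left_pos[of m N r] by linarith
    then show ?thesis using N \<open>d > 0\<close> by (auto simp: error_def)
  qed
  then show "eventually (\<lambda>z. dist (case z of (\<mu>, r) \<Rightarrow> error m \<mu> r) 0 < d) prod_at_top"
    unfolding eventually_prod_at_top by auto
qed

lemma t_bound_bigo:
  assumes m: "m \<ge> 1"
  shows "(\<lambda>(\<mu>, r). t_bound (error m) \<mu> r) \<in> O[principal ({1..} \<times> {2..})](\<lambda>(\<mu>, r). \<mu> * ln r)"
proof -
  obtain C where C: "\<And>r. r \<ge> 2 \<Longrightarrow> small_ratio_error m r \<le> C" using small_ratio_error_bounded[OF m] by blast
  have "norm (t_bound (error m) \<mu> r) \<le> (exp 2 * (1 + \<bar>C\<bar>)) * norm (\<mu> * ln r)"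
    if "\<mu> \<ge> 1" "r \<ge> 2" for \<mu> r
  proof -
    have "2 / (exp 1 * \<mu>) \<le> 1"
      using mult_mono[of "5/2" "exp 1" 1 \<mu>] exp_1_ge that by (simp add: field_simps)
    then have c: "c_const \<mu> \<le> exp 2" using c_const_props(2)[of \<mu>] that by (simp add: order_trans)
    have e: "0 \<le> error m \<mu> r" "error m \<mu> r \<le> \<bar>C\<bar>"
      using small_ratio_error_nonneg[OF m, of r] C[of r] that by (auto simp: error_def)
    have c0: "c_const \<mu> \<ge> 0" by (simp add: c_const_def)
    have "\<mu> * ln r \<ge> 0" using that by simp
    then have "(c_const \<mu> * (1 + error m \<mu> r)) * (\<mu> * ln r) \<le> (exp 2 * (1 + \<bar>C\<bar>)) * (\<mu> * ln r)"
      using c e c0 by (intro mult_right_mono mult_mono) auto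
    moreover have "t_bound (error m) \<mu> r = (c_const \<mu> * (1 + error m \<mu> r)) * (\<mu> * ln r)"
      by (simp add: t_bound_def mult_ac)
    moreover have "(c_const \<mu> * (1 + error m \<mu> r)) * (\<mu> * ln r) \<ge> 0"
      using \<open>\<mu> * ln r \<ge> 0\<close> c0 e by (intro mult_nonneg_nonneg[of _ "\<mu> * ln r"] mult_nonneg_nonneg[of "c_const \<mu>"]) auto
    ultimately show ?thesis using \<open>\<mu> * ln r \<ge> 0\<close> by (simp only: real_norm_def abs_of_nonneg)
  qed
  then show ?thesis
    by (intro bigoI[where c = "exp 2 * (1 + \<bar>C\<bar>)"]) (auto simp: eventually_principal)
qed

(* The vertex type 'a is arbitrary. As finite hypergraphs can be relabelled, the instance
   'a = nat gives one \<epsilon> that serves all vertex types.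
   For r = 1 the bound would be 0, as ln 1 = 0, hence r \<ge> 2.
   A bound in O[principal A] holds uniformly on all of A. *)
theorem theorem2p8:
  "\<exists>\<epsilon> :: real \<Rightarrow> real \<Rightarrow> real.
     (\<forall>\<mu>\<ge>0. \<forall>r\<ge>0. \<epsilon> \<mu> r \<ge> 0) \<and>
     ((\<lambda>(\<mu>, r). \<epsilon> \<mu> r) \<longlongrightarrow> 0) prod_at_top \<and>
     (\<forall>(V :: 'a set) E (r :: nat) (\<mu> :: real).
        hypergraph V E \<and> r \<ge> 2 \<and> uniform r E \<and> \<mu> \<ge> 0 \<and> near_regular \<mu> V E \<and> girth E \<ge> 4
        \<longrightarrow> (\<exists>M. M \<subseteq># E \<and> hitting V M \<and> shallow (t_bound \<epsilon> \<mu> (real r)) V M)) \<and>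
     (\<lambda>(\<mu>, r). t_bound \<epsilon> \<mu> r) \<in> O[principal ({1..} \<times> {2..})](\<lambda>(\<mu>, r). \<mu> * ln r) \<and>
     (\<lambda>\<mu>. c_const \<mu> - exp 1) \<in> o[at_top](\<lambda>_. 1)"
proof -
  obtain m where m: "m \<ge> 1" and large: "\<And>\<mu> r :: real. \<mu> \<ge> m \<Longrightarrow> r \<ge> 2 \<Longrightarrow>
     4 * exp ((1 + 4 / scale \<mu> r) * \<mu> * (ln r + (1 - 1 / r)) * (9 / 8 - 1)) * (9 / 8) *
       ((1 + 4 / scale \<mu> r) * \<mu> * (16 * scale \<mu> r ^ 4) * r)^3 \<le> (9 / 8) powr (exp 1 * \<mu> * ln r)"
    using chernoff_large_degree_ratio by blast
  show ?thesis
  proof (intro exI[of _ "error m"] conjI allI impI)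
    show "error m \<mu> r \<ge> 0" for \<mu> r using small_ratio_error_nonneg[OF m] by (simp add: error_def)
    show "((\<lambda>(\<mu>, r). error m \<mu> r) \<longlongrightarrow> 0) prod_at_top" by (rule error_tendsto[OF m])
    show "(\<lambda>(\<mu>, r). t_bound (error m) \<mu> r) \<in> O[principal ({1..} \<times> {2..})](\<lambda>(\<mu>, r). \<mu> * ln r)"
      by (rule t_bound_bigo[OF m])
    show "(\<lambda>\<mu>. c_const \<mu> - exp 1) \<in> o[at_top](\<lambda>_. 1)"
      by (rule smalloI_tendsto) (use LIM_zero[OF c_const_tendsto] in simp_all)
    fix V :: "'a set" and E and r :: nat and \<mu> :: real
    assume "hypergraph V E \<and> r \<ge> 2 \<and> uniform r E \<and> \<mu> \<ge> 0 \<and> near_regular \<mu> V E \<and> girth E \<ge> 4"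
    then have H: "hypergraph V E" "r \<ge> 2" "uniform r E" "near_regular \<mu> V E" "girth E \<ge> 4" by auto
    show "\<exists>M. M \<subseteq># E \<and> hitting V M \<and> shallow (t_bound (error m) \<mu> (real r)) V M"
    proof (cases "V = {}")
      \<comment> \<open>Near-regularity gives no information here, but every \<open>M\<close> is
        vacuously hitting and shallow.\<close>
      case True
      then show ?thesis by (auto simp: hitting_def shallow_def)
    next
      case False
      have "finite V" using H(1) by (simp add: hypergraph_def)
      note V = False
      have \<mu>: "\<mu> \<ge> 1" using near_regular_degrees(2)[OF H(4) \<open>finite V\<close> V] .
      have c: "exp 1 \<le> c_const \<mu>" using c_const_props(1)[of \<mu>] \<mu> by simp
      have \<mu>r: "\<mu> * ln r \<ge> 0" using \<mu> H(2) by simp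
      show ?thesis
      proof (cases "\<mu> \<ge> m")
        case True
        \<comment> \<open>In this range the stronger bound \<open>exp 1 * \<mu> * ln r\<close> holds
          without an error term; passing to \<open>c_const \<mu> \<ge> exp 1\<close> only weakens
          it.\<close>
        have "2 * (\<mu> * ln r) \<le> exp 1 * (\<mu> * ln r)"
          using exp_1_ge \<mu>r by (intro mult_right_mono) auto
        then have "\<exists>M. M \<subseteq># E \<and> hitting V M \<and> shallow (exp 1 * \<mu> * ln r) V M"
          using H(2) by (intro shallow_hitting_edge_set[OF H V \<mu> _ _ large[OF True]]) auto
        moreover have "exp 1 * (\<mu> * ln r) \<le> c_const \<mu> * (\<mu> * ln r)"
          using c \<mu>r by (rule mult_right_mono)
        then have "exp 1 * \<mu> * ln r \<le> t_bound (error m) \<mu> r"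
          using True by (simp add: t_bound_def error_def mult.assoc)
        ultimately show ?thesis using shallow_mono by blast
      next
        case False
        have t: "t_bound (error m) \<mu> r = c_const \<mu> * \<mu> * ln r * (1 + small_ratio_error m r)"
          using False H(2) by (simp add: t_bound_def error_def)
        have "2 * 1 * (\<mu> * ln r) \<le> c_const \<mu> * (1 + small_ratio_error m r) * (\<mu> * ln r)"
          using c exp_1_ge small_ratio_error_nonneg[OF m, of r] H(2) \<mu>r by (intro mult_right_mono mult_mono) auto
        then have "2 * \<mu> * ln r \<le> t_bound (error m) \<mu> r" unfolding t by (simp add: mult_ac)
        moreover have "1 \<le> c_const \<mu>" using c exp_1_ge by linarith
        ultimately show ?thesis
          using chernoff_small_degree_ratio[of \<mu> m r] \<mu> False H(2) unfolding t
          by (intro shallow_hitting_edge_set[OF H V \<mu>]) auto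
      qed
    qed
  qed
qed

end
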